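(* Let $p$ be a prime with $p\equiv 3\pmod 4$, $t\geq1$ an integer, $q=p^{2t}$ and $r=\frac{q-1}{4}$. Let $K(P^*(q))=K(P^*(q))_p\oplus K(P^*(q))_{p'}$ be the decomposition of the critical group of the Peisert graph $P^*(q)$ into its Sylow $p$-subgroup and its $p$-complement. Then $K(P^*(q))_{p'}\cong(\mathbb{Z}/r\mathbb{Z})^{2r}$, and the order of $K(P^*(q))_p$ is $q^{\frac{q-3}{2}}$.
   Context: Let $\beta$ be a primitive element of $\mathbb{F}_q$, $C_0$ the subgroup of nonzero fourth powers in $\mathbb{F}_q^\times$, and $S'=C_0\cup\beta C_0$. The Peisert graph $P^*(q)$ has vertex set $\mathbb{F}_q$, distinct $x,y$ adjacent iff $x-y\in S'$; it is regular of degree $\frac{q-1}{2}$. Its Laplacian is $L=\frac{q-1}{2}I-A$ with $A$ the adjacency matrix. The critical group $K(\Gamma)$ of a graph $\Gamma$ is the torsion subgroup of the cokernel of the Laplacian $L:\mathbb{Z}^{V}\to\mathbb{Z}^{V}$. *)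

theory Defs
  imports "HOL-Algebra.Algebra" "Graph_Theory.Graph_Theory"
begin

text \<open>Graphs are symmetric, loop-free \<open>pair_pre_digraph\<close>s: each edge is present as two opposite arcs.\<close>

definition laplacian :: "'v pair_pre_digraph \<Rightarrow> 'v \<Rightarrow> 'v \<Rightarrow> int" where
  "laplacian G x y =
     (if x = y then int (out_degree (with_proj G) x) else 0) - of_bool ((x, y) \<in> parcs G)"

text \<open>The group of integer vectors indexed by \<open>V\<close>; its elements are extensional functions, that is,
  they have the value \<open>undefined\<close> outside \<open>V\<close>.\<close>

definition int_vectors :: "'v set \<Rightarrow> ('v \<Rightarrow> int) monoid" where
  "int_vectors V = product_group V (\<lambda>_. integer_group)"

definition laplacian_map :: "'v pair_pre_digraph \<Rightarrow> ('v \<Rightarrow> int) \<Rightarrow> 'v \<Rightarrow> int" where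
  "laplacian_map G f = (\<lambda>x\<in>pverts G. \<Sum>y\<in>pverts G. laplacian G x y * f y)"

definition laplacian_cokernel :: "'v pair_pre_digraph \<Rightarrow> ('v \<Rightarrow> int) set monoid" where
  "laplacian_cokernel G =
     int_vectors (pverts G) Mod (laplacian_map G ` carrier (int_vectors (pverts G)))"

definition torsion_subgroup :: "('a, 'b) monoid_scheme \<Rightarrow> 'a set" where
  "torsion_subgroup G = {x \<in> carrier G. \<exists>n::nat. n > 0 \<and> x [^]\<^bsub>G\<^esub> n = \<one>\<^bsub>G\<^esub>}"

definition critical_group :: "'v pair_pre_digraph \<Rightarrow> ('v \<Rightarrow> int) set monoid" where
  "critical_group G =
     (laplacian_cokernel G)\<lparr>carrier := torsion_subgroup (laplacian_cokernel G)\<rparr>"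

definition sylow_subgroup :: "nat \<Rightarrow> ('a, 'b) monoid_scheme \<Rightarrow> 'a set \<Rightarrow> bool" where
  "sylow_subgroup p G P \<longleftrightarrow>
     finite (carrier G) \<and> subgroup P G \<and> card P = p ^ multiplicity p (order G)"

text \<open>For a commutative group \<open>G\<close>, the following says that \<open>G\<close> is the internal direct sum of its Sylow
  \<open>p\<close>-subgroup \<open>P\<close> and its \<open>p\<close>-complement \<open>Q\<close>.\<close>

definition sylow_decomposition ::
    "nat \<Rightarrow> ('a, 'b) monoid_scheme \<Rightarrow> 'a set \<Rightarrow> 'a set \<Rightarrow> bool" where
  "sylow_decomposition p G P Q \<longleftrightarrow>
     sylow_subgroup p G P \<and> subgroup Q G \<and> P \<inter> Q = {\<one>\<^bsub>G\<^esub>} \<and> P <#>\<^bsub>G\<^esub> Q = carrier G"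

definition primitive_element :: "'a::field \<Rightarrow> bool" where
  "primitive_element \<beta> \<longleftrightarrow> \<beta> \<noteq> 0 \<and> (\<forall>x. x \<noteq> 0 \<longrightarrow> (\<exists>n::nat. x = \<beta> ^ n))"

definition fourth_powers :: "'a::field set" where
  "fourth_powers = {x ^ 4 | x. x \<noteq> 0}"

definition peisert_set :: "'a::field \<Rightarrow> 'a set" where
  "peisert_set \<beta> = fourth_powers \<union> (\<lambda>x. \<beta> * x) ` fourth_powers"

definition peisert_graph :: "'a::field \<Rightarrow> 'a pair_pre_digraph" where
  "peisert_graph \<beta> =
     \<lparr>pverts = UNIV, parcs = {(x, y). x \<noteq> y \<and> x - y \<in> peisert_set \<beta>}\<rparr>"

end

theory Submission
  imports Defs "HOL-Library.Function_Algebras" Complex_Main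
begin

text \<open>Write \<open>q = s\<^sup>2\<close>. Because \<open>p \<equiv> 3 (mod 4)\<close>, the Jacobi sum of a quartic character with itself is
  real, which makes the Peisert graph a conference graph: on the lattice \<open>Y\<close> of integer vectors with
  sum \<open>0\<close> the Laplacian \<open>L\<close> satisfies \<open>(L - a) (L - b) = 0\<close> with \<open>a = s (s - 1) / 2\<close>,
  \<open>b = s (s + 1) / 2\<close> and \<open>a b = q r\<close>. Multiplication by \<open>\<beta>\<^sup>2\<close> maps the graph to its complement and
  hence the \<open>a\<close>-eigenlattice isomorphically to the \<open>b\<close>-eigenlattice; both have rank \<open>2 r\<close>, and their
  sum \<open>E\<close> contains \<open>s Y\<close>. Comparing indices gives \<open>[Y : L Y] = [E : L E] = (a b)\<^bsup>2r\<^esup>\<close>, and dividing by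
  \<open>[L \<int>\<^sup>V : L Y] = q\<close> one obtains the order \<open>q\<^bsup>2r - 1\<^esup> r\<^bsup>2r\<^esup>\<close> of the critical group. Away from \<open>p\<close> the
  group splits along the eigenlattices into parts killed by the coprime numbers \<open>(s - 1) / 2\<close> and
  \<open>(s + 1) / 2\<close>, so the \<open>p\<close>-complement is killed by their product \<open>r\<close> and is generated by \<open>2 r\<close> elements;
  having order \<open>r\<^bsup>2r\<^esup>\<close>, it is \<open>(\<int>/r\<int>)\<^bsup>2r\<^esup>\<close>.\<close>

section \<open>Indices of lattices\<close>

text \<open>Over the integers, submodules are the same as subgroups. With this scaling
  \<open>zmod.subspace\<close> therefore means sublattice, and the module theory of spans and
  independence applies.\<close>

definition zscale :: "int \<Rightarrow> ('a \<Rightarrow> int) \<Rightarrow> 'a \<Rightarrow> int" (infixr "*\<^sub>z" 75) where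
  "c *\<^sub>z f = (\<lambda>x. c * f x)"

text \<open>Not a simp rule: it would also rewrite the scalar multiplication inside \<open>zmod.subspace\<close> and
  \<open>zmod.span\<close>.\<close>

lemma zscale_apply: "(c *\<^sub>z f) x = c * f x"
  by (simp add: zscale_def)

interpretation zmod: Modules.module "zscale :: int \<Rightarrow> ('a \<Rightarrow> int) \<Rightarrow> 'a \<Rightarrow> int"
  by standard (auto simp: zscale_apply fun_eq_iff algebra_simps)

definition add_cosets :: "'b::ab_group_add set \<Rightarrow> 'b set \<Rightarrow> 'b set set" where
  "add_cosets H K = (\<lambda>x. (+) x ` K) ` H"

text \<open>The index [H : K]. An infinite index is recorded as 0, so positivity expresses that the
  index is finite.\<close>

definition add_index :: "'b::ab_group_add set \<Rightarrow> 'b set \<Rightarrow> nat" where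
  "add_index H K = card (add_cosets H K)"

lemma coset_eq_iff:
  assumes "zmod.subspace K"
  shows "(+) x ` K = (+) y ` K \<longleftrightarrow> x - y \<in> K"
proof
  assume "(+) x ` K = (+) y ` K"
  then have "x \<in> (+) y ` K"
    using zmod.subspace_0[OF assms] by force
  then show "x - y \<in> K" by auto
next
  assume d: "x - y \<in> K"
  have "(+) u ` K \<subseteq> (+) v ` K" if "u - v \<in> K" for u v
  proof
    fix w assume "w \<in> (+) u ` K"
    then obtain k where "k \<in> K" "w = u + k" by auto
    then have "w = v + ((u - v) + k)" "(u - v) + k \<in> K"
      using that zmod.subspace_add[OF assms] by auto
    then show "w \<in> (+) v ` K" by blast
  qed
  moreover have "y - x \<in> K"
    using zmod.subspace_neg[OF assms d] by simp
  ultimately show "(+) x ` K = (+) y ` K" using d by blast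
qed

text \<open>Fixing a representative \<open>rep C\<close> of every coset \<open>C\<close> of
  \<open>M\<close>, each coset of \<open>K\<close> in \<open>H\<close> is \<open>rep C + D\<close>
  for exactly one pair \<open>(C, D)\<close>. The bijection exists for infinite indices too, where
  both sides are 0; positivity of a factor can thus be read off from the product.\<close>

lemma index_tower:
  assumes K: "zmod.subspace K" and M: "zmod.subspace M" and H: "zmod.subspace H"
    and "K \<subseteq> M" "M \<subseteq> H"
  shows "add_index H K = add_index H M * add_index M K"
proof -
  define rep :: "('a \<Rightarrow> int) set \<Rightarrow> 'a \<Rightarrow> int" where "rep C = (SOME x. x \<in> C)" for C
  have rep: "rep C \<in> H \<and> C = (+) (rep C) ` M" if C: "C \<in> add_cosets H M" for C
  proof -
    obtain h where h: "h \<in> H" "C = (+) h ` M"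
      using C unfolding add_cosets_def by blast
    have "h \<in> C" using h zmod.subspace_0[OF M] by force
    then have "rep C \<in> C" unfolding rep_def by (rule someI[of "\<lambda>x. x \<in> C"])
    then obtain m where m: "m \<in> M" "rep C = h + m" using h by auto
    have "rep C \<in> H" using m h zmod.subspace_add[OF H] assms(5) by auto
    have "h - rep C \<in> M" using m zmod.subspace_neg[OF M] by simp
    note h(2)
    also have "(+) h ` M = (+) (rep C) ` M"
      using coset_eq_iff[OF M] \<open>h - rep C \<in> M\<close> by blast
    finally have "C = (+) (rep C) ` M" .
    with \<open>rep C \<in> H\<close> show ?thesis by blast
  qed
  let ?f = "\<lambda>(C, D). (+) (rep C) ` D"
  let ?S = "Sigma (add_cosets H M) (\<lambda>_. add_cosets M K)"
  have coset_shift: "(+) u ` ((+) v ` K) = (+) (u + v) ` K" for u v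
    by (auto simp: image_image add.assoc)
  have "bij_betw ?f ?S (add_cosets H K)"
  proof (rule bij_betwI')
    fix U Y assume XY: "U \<in> ?S" "Y \<in> ?S"
    obtain C m where U: "U = (C, (+) m ` K)" "C \<in> add_cosets H M" "m \<in> M"
      using XY by (auto simp: add_cosets_def)
    obtain C' m' where Y: "Y = (C', (+) m' ` K)" "C' \<in> add_cosets H M" "m' \<in> M"
      using XY by (auto simp: add_cosets_def)
    show "?f U = ?f Y \<longleftrightarrow> U = Y"
    proof
      assume "?f U = ?f Y"
      then have k: "(rep C + m) - (rep C' + m') \<in> K"
        using U Y coset_shift coset_eq_iff[OF K] by simp
      then have "((rep C + m) - (rep C' + m')) + (m' - m) \<in> M"
        using assms(4) U(3) Y(3) zmod.subspace_add[OF M] zmod.subspace_diff[OF M] by blast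
      then have "rep C - rep C' \<in> M" by (simp add: algebra_simps)
      then have C: "C = C'"
        using rep U(2) Y(2) coset_eq_iff[OF M] by metis
      then have "(+) m ` K = (+) m' ` K" using k coset_eq_iff[OF K] by simp
      then show "U = Y" using U Y C by simp
    qed auto
  next
    fix U assume U: "U \<in> ?S"
    then obtain C m where "U = (C, (+) m ` K)" "C \<in> add_cosets H M" "m \<in> M"
      by (auto simp: add_cosets_def)
    then show "?f U \<in> add_cosets H K"
      using rep[of C] assms(5) zmod.subspace_add[OF H] coset_shift by (auto simp: add_cosets_def)
  next
    fix Z assume "Z \<in> add_cosets H K"
    then obtain h where h: "h \<in> H" "Z = (+) h ` K" by (auto simp: add_cosets_def)
    let ?C = "(+) h ` M"
    have C: "?C \<in> add_cosets H M" using h by (auto simp: add_cosets_def)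
    then have "h - rep ?C \<in> M" using rep coset_eq_iff[OF M] by metis
    then have "(?C, (+) (h - rep ?C) ` K) \<in> ?S"
      using C by (auto simp: add_cosets_def)
    moreover have "Z = ?f (?C, (+) (h - rep ?C) ` K)" using coset_shift h by simp
    ultimately show "\<exists>U\<in>(?S). Z = ?f U" by blast
  qed
  then show ?thesis
    by (simp add: add_index_def bij_betw_same_card card_cartesian_product[symmetric])
qed

lemma index_image:
  assumes "Modules.additive f" and "inj_on f H" "K \<subseteq> H" "zmod.subspace H"
  shows "add_index (f ` H) (f ` K) = add_index H K"
proof -
  have "f ` ((+) x ` K) = (+) (f x) ` (f ` K)" for x
    using additive.add[OF assms(1)] by (simp add: image_image)
  then have "add_cosets (f ` H) (f ` K) = (`) f ` add_cosets H K"
    by (auto simp: add_cosets_def image_image)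
  moreover have "add_cosets H K \<subseteq> Pow H"
    using assms(3) zmod.subspace_add[OF assms(4)] by (auto simp: add_cosets_def)
  then have "inj_on ((`) f) (add_cosets H K)"
    using inj_on_image_Pow[OF assms(2)] inj_on_subset by blast
  ultimately show ?thesis by (simp add: add_index_def card_image)
qed

text \<open>This replaces determinants: the index of the image of \<open>f\<close> may be computed on any sublattice of
  finite index that \<open>f\<close> preserves.\<close>

lemma index_image_commensurable:
  assumes f: "module_hom zscale zscale f" and inj: "inj_on f Y"
    and Y: "zmod.subspace Y" and E: "zmod.subspace E" and "E \<subseteq> Y" "f ` Y \<subseteq> Y" "f ` E \<subseteq> E"
    and pos: "add_index Y E > 0"
  shows "add_index Y (f ` Y) = add_index E (f ` E)"
proof -
  interpret f: module_hom zscale zscale f by fact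
  have "Modules.additive f" by standard (rule f.add)
  then have "add_index (f ` Y) (f ` E) = add_index Y E"
    using index_image inj assms(5) Y by blast
  moreover have "add_index Y (f ` E) = add_index Y E * add_index E (f ` E)"
    by (rule index_tower) (use assms f.subspace_image in auto)
  moreover have "add_index Y (f ` E) = add_index Y (f ` Y) * add_index (f ` Y) (f ` E)"
    by (rule index_tower) (use assms f.subspace_image in auto)
  ultimately show ?thesis using pos by simp
qed

text \<open>In coordinates with respect to \<open>B\<close> the image consists of the vectors whose
  \<open>v\<close>-th coordinate is divisible by \<open>D v\<close>. Coordinate vectors reduced to
  \<open>0..<D v\<close> hence represent every coset exactly once.\<close>

lemma index_diagonal:
  assumes f: "module_hom zscale zscale f" and B: "finite B" "zmod.independent B"
    and D: "\<And>v. v \<in> B \<Longrightarrow> D v > 0 \<and> f v = D v *\<^sub>z v"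
  shows "int (add_index (zmod.span B) (f ` zmod.span B)) = (\<Prod>v\<in>B. D v)"
proof -
  interpret f: module_hom zscale zscale f by fact
  define comb where "comb c = (\<Sum>v\<in>B. c v *\<^sub>z v)" for c
  have span: "zmod.span B = range comb"
    using zmod.span_finite[OF B(1)] by (simp add: comb_def)
  have comb_diff: "comb c - comb c' = comb (\<lambda>v. c v - c' v)" for c c'
    by (simp add: comb_def sum_subtractf[symmetric] zmod.scale_left_diff_distrib)
  have f_comb: "f (comb c) = comb (\<lambda>v. D v * c v)" for c
    using D by (auto simp: comb_def f.sum f.scale mult.commute intro!: sum.cong)
  have comb_0: "c v = 0" if "comb c = 0" "v \<in> B" for c v
    using zmod.independentD[OF B(2,1) order_refl] that by (auto simp: comb_def)
  have K: "zmod.subspace (f ` zmod.span B)" by (simp add: f.subspace_image)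
  let ?P = "PiE B (\<lambda>v. {0..<D v})"
  have "bij_betw (\<lambda>c. (+) (comb c) ` (f ` zmod.span B)) ?P (add_cosets (zmod.span B) (f ` zmod.span B))"
  proof (rule bij_betwI')
    fix c c' assume c: "c \<in> ?P" "c' \<in> ?P"
    show "(+) (comb c) ` (f ` zmod.span B) = (+) (comb c') ` (f ` zmod.span B) \<longleftrightarrow> c = c'"
    proof
      assume "(+) (comb c) ` (f ` zmod.span B) = (+) (comb c') ` (f ` zmod.span B)"
      then have "comb c - comb c' \<in> f ` zmod.span B" using coset_eq_iff[OF K] by blast
      then obtain e where "comb (\<lambda>v. c v - c' v) = comb (\<lambda>v. D v * e v)"
        using span f_comb comb_diff by auto
      then have "comb (\<lambda>v. (c v - c' v) - D v * e v) = 0"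
        by (simp add: comb_diff[symmetric])
      then have "c v - c' v = D v * e v" if "v \<in> B" for v
        using comb_0[of "\<lambda>v. (c v - c' v) - D v * e v"] that by simp
      then have "c v mod D v = c' v mod D v" if "v \<in> B" for v
        using that by (metis dvd_triv_left mod_eq_dvd_iff)
      moreover have "c v mod D v = c v" "c' v mod D v = c' v" if "v \<in> B" for v
        using PiE_mem[OF c(1) that] PiE_mem[OF c(2) that] by auto
      ultimately show "c = c'" using c by (intro PiE_ext[of _ B]) auto
    qed auto
  next
    fix c show "(+) (comb c) ` (f ` zmod.span B) \<in> add_cosets (zmod.span B) (f ` zmod.span B)"
      using span by (auto simp: add_cosets_def)
  next
    fix Z assume "Z \<in> add_cosets (zmod.span B) (f ` zmod.span B)"
    then obtain c where Z: "Z = (+) (comb c) ` (f ` zmod.span B)"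
      using span by (auto simp: add_cosets_def)
    let ?c = "\<lambda>v\<in>B. c v mod D v"
    have "comb c - comb ?c = comb (\<lambda>v. D v * (c v div D v))"
      unfolding comb_diff by (auto simp: comb_def minus_mod_eq_mult_div intro!: sum.cong)
    also have "\<dots> \<in> f ` zmod.span B" using f_comb span by (metis rangeI image_eqI)
    finally have "Z = (+) (comb ?c) ` (f ` zmod.span B)" using Z coset_eq_iff[OF K] by blast
    moreover have "?c \<in> ?P" using D by auto
    ultimately show "\<exists>c\<in>?P. Z = (+) (comb c) ` (f ` zmod.span B)" by blast
  qed
  then have "add_index (zmod.span B) (f ` zmod.span B) = card ?P"
    by (simp add: add_index_def bij_betw_same_card)
  also have "\<dots> = (\<Prod>v\<in>B. nat (D v))" using B by (simp add: card_PiE)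
  finally show ?thesis using D by (simp add: less_imp_le)
qed

section \<open>Bases of sublattices\<close>

text \<open>Division with remainder by the least positive element leaves remainder 0. The trivial
  subgroup yields \<open>g = 0\<close>.\<close>

lemma int_subgroup_principal:
  fixes H :: "int set"
  assumes "0 \<in> H" "\<And>x y. x \<in> H \<Longrightarrow> y \<in> H \<Longrightarrow> x - y \<in> H"
  obtains g where "g \<in> H" "\<And>x. x \<in> H \<Longrightarrow> g dvd x"
proof (cases "\<exists>x\<in>H. x > 0")
  case True
  define P where "P n \<longleftrightarrow> n > 0 \<and> int n \<in> H" for n
  define n where "n = (LEAST n. P n)"
  have "\<exists>n. P n" using True unfolding P_def by (metis int_nat_eq order_less_imp_le zero_less_nat_eq)
  then have n: "P n" unfolding n_def by (rule LeastI_ex)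
  have mult: "x - int k * int n \<in> H" if "x \<in> H" for x k
  proof (induction k)
    case (Suc k)
    then have "x - int k * int n - int n \<in> H" using n assms(2) by (simp add: P_def)
    then show ?case by (simp add: algebra_simps)
  qed (use that in simp)
  have dvd: "int n dvd x" if "x \<in> H" "x \<ge> 0" for x
  proof -
    have "x - int (nat (x div int n)) * int n \<in> H" using mult that by blast
    then have "x mod int n \<in> H" using that n
      by (simp add: P_def minus_div_mult_eq_mod pos_imp_zdiv_nonneg_iff)
    moreover have "x mod int n < int n" "x mod int n \<ge> 0" using n by (auto simp: P_def)
    ultimately have "x mod int n = 0"
      using not_less_Least[of "nat (x mod int n)" P] unfolding n_def[symmetric] by (auto simp: P_def)
    then show ?thesis by auto
  qed
  have "int n dvd x" if "x \<in> H" for x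
    using dvd[of x] dvd[of "0 - x"] assms(2)[OF assms(1) that] that by (cases "x \<ge> 0") auto
  then show ?thesis using that n by (auto simp: P_def)
next
  case False
  have "x = 0" if "x \<in> H" for x
    using False assms(2)[OF assms(1) that] that by force
  then show ?thesis using that assms(1) by force
qed

text \<open>Induction on the support. The values at the new coordinate \<open>i\<close> form a
  principal subgroup generated by \<open>g\<close>; an element \<open>h0\<close> taking the value
  \<open>g\<close> at \<open>i\<close> splits \<open>H\<close> into multiples of \<open>h0\<close>
  and the part \<open>H'\<close> vanishing at \<open>i\<close>, which has a basis by
  induction.\<close>

lemma subspace_has_basis_support:
  assumes "finite I" "zmod.subspace H" "\<And>h i. h \<in> H \<Longrightarrow> i \<notin> I \<Longrightarrow> h i = 0"
  shows "\<exists>B. finite B \<and> zmod.independent B \<and> zmod.span B = H"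
  using assms
proof (induction I arbitrary: H rule: finite_induct)
  case empty
  then have "H = {0}" using zmod.subspace_0[OF empty(1)] by (auto simp: fun_eq_iff)
  then show ?case
    using zmod.independent_empty zmod.span_empty finite.emptyI by metis
next
  case (insert i I)
  let ?A = "(\<lambda>h. h i) ` H"
  have "0 \<in> ?A"
    using zmod.subspace_0[OF insert.prems(1)] by (intro image_eqI[of _ _ 0]) auto
  moreover have "x - y \<in> ?A" if xy: "x \<in> ?A" "y \<in> ?A" for x y
  proof -
    obtain h k where "h \<in> H" "k \<in> H" "x = h i" "y = k i" using xy by auto
    then show ?thesis
      using zmod.subspace_diff[OF insert.prems(1)] by (intro image_eqI[of _ _ "h - k"]) auto
  qed
  ultimately obtain g where g: "g \<in> ?A" "\<And>x. x \<in> ?A \<Longrightarrow> g dvd x"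
    using int_subgroup_principal[of ?A] by blast
  then obtain h0 where h0: "h0 \<in> H" "h0 i = g" by auto
  define H' where "H' = {h \<in> H. h i = 0}"
  have "zmod.subspace H'"
    using zmod.subspace_0[OF insert.prems(1)] zmod.subspace_add[OF insert.prems(1)]
      zmod.subspace_scale[OF insert.prems(1)]
    by (intro zmod.subspaceI) (auto simp: H'_def zscale_apply)
  moreover have "h j = 0" if "h \<in> H'" "j \<notin> I" for h j
    using that insert.prems(2) by (cases "j = i") (auto simp: H'_def)
  ultimately obtain B where B: "finite B" "zmod.independent B" "zmod.span B = H'"
    using insert.IH by blast
  show ?case
  proof (cases "g = 0")
    case True
    then have "H' = H" using g(2) by (auto simp: H'_def)
    then show ?thesis using B by blast
  next
    case False
    have "h0 \<notin> zmod.span B" using B h0 False by (simp add: H'_def)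
    have nB: "h0 \<notin> B" using B h0 False zmod.span_base[of h0 B] by (auto simp: H'_def)
    have "zmod.independent (insert h0 B)"
      unfolding zmod.dependent_finite[OF finite.insertI[OF B(1)]]
    proof clarify
      fix u v assume v: "v \<in> insert h0 B" "u v \<noteq> 0" and "(\<Sum>v\<in>insert h0 B. u v *\<^sub>z v) = 0"
      then have 0: "u h0 *\<^sub>z h0 + (\<Sum>v\<in>B. u v *\<^sub>z v) = 0" using B nB by simp
      have "(\<Sum>v\<in>B. u v *\<^sub>z v) \<in> H'"
        unfolding B(3)[symmetric] by (intro zmod.span_sum zmod.span_scale zmod.span_base)
      then have "(\<Sum>v\<in>B. u v *\<^sub>z v) i = 0" by (simp add: H'_def)
      then have "u h0 * g = 0" using fun_cong[OF 0, of i] h0 by (simp add: zscale_apply)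
      then have "u h0 = 0" using False by simp
      then have "(\<Sum>v\<in>B. u v *\<^sub>z v) = 0" "v \<in> B" using 0 v by auto
      then show False using zmod.independentD[OF B(2,1) order_refl] v by blast
    qed
    moreover have "zmod.span (insert h0 B) = H"
    proof (rule zmod.span_subspace)
      show "insert h0 B \<subseteq> H" using B h0 zmod.span_superset[of B] by (auto simp: H'_def)
      show "H \<subseteq> zmod.span (insert h0 B)"
      proof
        fix h assume h: "h \<in> H"
        then obtain k where "h i = g * k" using g(2) by (auto simp: dvd_def)
        then have "h - k *\<^sub>z h0 \<in> H'"
          using h h0 zmod.subspace_diff[OF insert.prems(1)] zmod.subspace_scale[OF insert.prems(1)]
          by (auto simp: H'_def zscale_apply)
        then show "h \<in> zmod.span (insert h0 B)" unfolding zmod.span_insert using B by blast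
      qed
    qed (fact insert.prems(1))
    ultimately show ?thesis using B by blast
  qed
qed

lemma subspace_has_basis:
  fixes H :: "('a::finite \<Rightarrow> int) set"
  assumes "zmod.subspace H"
  obtains B where "finite B" "zmod.independent B" "zmod.span B = H"
  using subspace_has_basis_support[OF finite assms] that by blast

section \<open>Sylow decompositions of finite abelian groups\<close>

lemma (in comm_group) card_set_mult_trivial_Int:
  assumes P: "subgroup P G" and Q: "subgroup Q G" and "P \<inter> Q = {\<one>}"
  shows "card (P <#> Q) = card P * card Q"
proof -
  have "inj_on (\<lambda>(x, y). x \<otimes> y) (P \<times> Q)"
  proof (rule inj_onI, clarify)
    fix x y x' y' assume x: "x \<in> P" "x' \<in> P" and y: "y \<in> Q" "y' \<in> Q" and eq: "x \<otimes> y = x' \<otimes> y'"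
    note [simp] = subgroup.mem_carrier[OF P] subgroup.mem_carrier[OF Q]
    have "inv x' \<otimes> x = inv x' \<otimes> (x \<otimes> y) \<otimes> inv y"
      using x y by (simp add: m_assoc)
    also have "\<dots> = y' \<otimes> inv y"
      using x y by (simp add: eq m_assoc[symmetric])
    finally have *: "inv x' \<otimes> x = y' \<otimes> inv y" .
    moreover have "inv x' \<otimes> x \<in> P" "y' \<otimes> inv y \<in> Q"
      using x y P Q by (simp_all add: subgroup.m_closed subgroup.m_inv_closed)
    ultimately have "inv x' \<otimes> x = \<one>" "y' \<otimes> inv y = \<one>" using assms(3) by auto
    then show "x = x' \<and> y = y'" using x y
      by (metis P Q inv_closed inv_equality inv_inv subgroup.mem_carrier)
  qed
  moreover have "P <#> Q = (\<lambda>(x, y). x \<otimes> y) ` (P \<times> Q)" by (auto simp: set_mult_def)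
  ultimately show ?thesis by (simp add: card_image card_cartesian_product)
qed

lemma (in group) pow_card_subgroup:
  assumes "subgroup H G" "x \<in> H"
  shows "x [^] card H = \<one>"
proof -
  interpret H: group "G\<lparr>carrier := H\<rparr>" using assms subgroup_imp_group by blast
  have "x [^]\<^bsub>G\<lparr>carrier := H\<rparr>\<^esub> Coset.order (G\<lparr>carrier := H\<rparr>) = \<one>"
    using H.pow_order_eq_1[of x] assms by simp
  then show ?thesis unfolding nat_pow_consistent[symmetric] by (simp add: Coset.order_def)
qed

text \<open>The complement is the \<open>m\<close>-torsion, where the group has order
  \<open>p ^ a * m\<close>. Since \<open>G Mod P\<close> has order \<open>m\<close>, every
  \<open>x [^] m\<close> lies in \<open>P\<close>, and a Bezout relation between
  \<open>p ^ a\<close> and \<open>m\<close> writes \<open>x\<close> as a product of an element of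
  \<open>P\<close> and one of \<open>Q\<close>.\<close>

lemma (in comm_group) sylow_decomposition_exists:
  assumes "finite (carrier G)" and p: "Factorial_Ring.prime p"
  shows "\<exists>P Q. sylow_decomposition p G P Q"
proof -
  define a where "a = multiplicity p (Coset.order G)"
  have pos: "Coset.order G > 0" using assms(1) order_gt_0_iff_finite by blast
  then have "Coset.order G \<noteq> 0" "\<not> is_unit p" using p by auto
  then obtain m where m: "Coset.order G = p ^ a * m" "\<not> p dvd m"
    unfolding a_def by (rule multiplicity_decompose')
  then have cop: "coprime (p ^ a) m" using p by (simp add: prime_imp_coprime)
  obtain P where P: "subgroup P G" "card P = p ^ a"
    using sylow_thm[OF p is_group m(1) assms(1)] by blast
  define Q where "Q = {x \<in> carrier G. x [^] m = \<one>}"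
  have Q: "subgroup Q G"
    by (rule subgroupI) (auto simp: Q_def pow_mult_distrib m_comm nat_pow_inv intro!: exI[of _ \<one>])
  interpret P: normal P G using P subgroup_imp_normal by blast
  have "finite P" using P assms(1) finite_subset subgroup.subset by blast
  have pow_P: "x [^] p ^ a = \<one>" if "x \<in> P" for x
    using pow_card_subgroup[OF P(1) that] P by simp
  have pow_m: "x [^] m \<in> P" if "x \<in> carrier G" for x
  proof -
    interpret GP: group "G Mod P" by (rule P.factorgroup_is_group)
    have "card (rcosets P) * p ^ a = p ^ a * m"
      using lagrange[OF P(1)] P m by simp
    then have "Coset.order (G Mod P) = m"
      using p by (simp add: Coset.order_def FactGroup_def prime_gt_0_nat)
    then have "(P #> x) [^]\<^bsub>G Mod P\<^esub> m = P"
      using GP.pow_order_eq_1[of "P #> x"] that by (auto simp: carrier_FactGroup)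
    then have "P #> (x [^] m) = P" using P.FactGroup_pow that by simp
    then show ?thesis using that P by (metis nat_pow_closed rcos_self)
  qed
  have "P \<inter> Q = {\<one>}"
  proof -
    have "x = \<one>" if "x \<in> P" "x \<in> Q" for x
    proof -
      have x: "x \<in> carrier G" using that by (simp add: Q_def)
      have "ord x dvd p ^ a" "ord x dvd m" using pow_P that x by (simp_all add: pow_eq_id[symmetric] Q_def)
      then have "ord x = 1" using cop coprime_common_divisor_nat by blast
      then show ?thesis using x ord_eq_1 by blast
    qed
    then show ?thesis using P Q subgroup.one_closed by blast
  qed
  moreover have "P <#> Q = carrier G"
  proof
    show "P <#> Q \<subseteq> carrier G" using P Q by (simp add: set_mult_closed subgroup.subset)
    show "carrier G \<subseteq> P <#> Q"
    proof
      fix x assume x: "x \<in> carrier G"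
      obtain u v where "int (p ^ a) * u + int m * v = 1"
        using cop by (metis bezout_int coprime_iff_gcd_eq_1 gcd_int_int_eq mult.commute of_nat_1)
      then have "x = x [^] (int m * v + int (p ^ a) * u)" using x by (simp add: add.commute)
      also have "\<dots> = (x [^] m) [^] v \<otimes> (x [^] u) [^] (p ^ a)"
        using x by (simp add: int_pow_mult int_pow_pow int_pow_int[symmetric] mult.commute)
      finally have "x = (x [^] m) [^] v \<otimes> (x [^] u) [^] (p ^ a)" .
      moreover have "(x [^] m) [^] v \<in> P" using P pow_m x subgroup_int_pow_closed by blast
      moreover have "((x [^] u) [^] (p ^ a)) [^] m = \<one>"
        using pow_order_eq_1[of "x [^] u"] x m(1) by (simp add: nat_pow_pow)
      ultimately show "x \<in> P <#> Q" using x unfolding set_mult_def Q_def by blast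
    qed
  qed
  ultimately show ?thesis using P Q assms(1) unfolding sylow_decomposition_def sylow_subgroup_def a_def by blast
qed

text \<open>Counting \<open>P <#> Q\<close> gives the orders. The \<open>P\<close>-component of an
  \<open>m\<close>-torsion element has order dividing both \<open>p ^ a\<close> and
  \<open>m\<close>, so it is trivial. This pins \<open>Q\<close> down in an arbitrary decomposition,
  as needed for a statement about all of them.\<close>

lemma (in comm_group) sylow_decomposition_complement:
  assumes dec: "sylow_decomposition p G P Q" and ord: "Coset.order G = p ^ a * m"
    and p: "Factorial_Ring.prime p" "\<not> p dvd m"
  shows "card P = p ^ a" "card Q = m" "Q = {x \<in> carrier G. x [^] m = \<one>}"
proof -
  have P: "subgroup P G" and Q: "subgroup Q G"
    and PQ: "P \<inter> Q = {\<one>}" "P <#> Q = carrier G"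
    and cP: "card P = p ^ multiplicity p (Coset.order G)"
    using dec by (auto simp: sylow_decomposition_def sylow_subgroup_def)
  have "multiplicity p (p ^ a * m) = a"
    using p by (intro multiplicity_eqI) (auto simp: prime_gt_0_nat)
  then show cP: "card P = p ^ a" using cP ord by simp
  have "card P * card Q = p ^ a * m"
    using card_set_mult_trivial_Int[OF P Q PQ(1)] PQ(2) ord by (simp add: Coset.order_def)
  then show cQ: "card Q = m" using cP p by (simp add: prime_gt_0_nat)
  have cop: "coprime (p ^ a) m" using p by (simp add: prime_imp_coprime)
  show "Q = {x \<in> carrier G. x [^] m = \<one>}"
  proof (intro equalityI subsetI)
    fix x assume "x \<in> Q"
    then show "x \<in> {x \<in> carrier G. x [^] m = \<one>}"
      using pow_card_subgroup[OF Q] cQ subgroup.mem_carrier[OF Q] by auto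
  next
    fix x assume x: "x \<in> {x \<in> carrier G. x [^] m = \<one>}"
    then obtain u w where uw: "u \<in> P" "w \<in> Q" "x = u \<otimes> w"
      using PQ(2) unfolding set_mult_def by blast
    have c: "u \<in> carrier G" "w \<in> carrier G"
      using subgroup.mem_carrier[OF P uw(1)] subgroup.mem_carrier[OF Q uw(2)] by simp_all
    have "u [^] m = \<one>" using x uw c pow_card_subgroup[OF Q uw(2)] cQ by (simp add: pow_mult_distrib m_comm)
    moreover have "u [^] p ^ a = \<one>" using pow_card_subgroup[OF P uw(1)] cP by simp
    ultimately have "ord u dvd p ^ a" "ord u dvd m" using c by (simp_all add: pow_eq_id)
    then have "ord u = 1" using cop coprime_common_divisor_nat by blast
    then show "x \<in> Q" using uw c ord_eq_1 by simp
  qed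
qed

section \<open>Conference Laplacians\<close>

definition sum_zero :: "('a::finite \<Rightarrow> int) set" where
  "sum_zero = {y. sum y UNIV = 0}"

definition unit_vec :: "'a \<Rightarrow> 'a \<Rightarrow> int" where
  "unit_vec z = (\<lambda>x. of_bool (x = z))"

lemma sum_zscale: "sum (c *\<^sub>z g) A = c * sum g A"
  by (simp add: zscale_apply sum_distrib_left)

lemma sum_plus_fun: "sum (f + g) A = sum f A + sum g (A :: 'a set)" for f g :: "'a \<Rightarrow> int"
  by (simp add: sum.distrib)

lemma sum_minus_fun: "sum (f - g) A = sum f A - sum g (A :: 'a set)" for f g :: "'a \<Rightarrow> int"
  by (simp add: sum_subtractf)

lemma sum_fun_apply: "(\<Sum>i\<in>A. f i) x = (\<Sum>i\<in>A. f i x)" for f :: "'b \<Rightarrow> 'a \<Rightarrow> int"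
  by (induction A rule: infinite_finite_induct) auto

lemma sum_unit_vec [simp]: "sum (unit_vec z) UNIV = (1 :: int)" for z :: "'a::finite"
  by (simp add: unit_vec_def of_bool_def)

lemma subspace_sum_zero: "zmod.subspace sum_zero"
  by (intro zmod.subspaceI) (auto simp: sum_zero_def sum_plus_fun sum_zscale sum.distrib)

text \<open>Away from \<open>z\<close> the vector \<open>b x\<close> looks like a unit vector, so
  coefficients can be read off there; the coordinate at \<open>z\<close> is then forced by the
  vanishing sum. The size of the basis gives the index of \<open>k Y\<close> in
  \<open>Y\<close>.\<close>

lemma sum_zero_basis:
  fixes z :: "'a::finite"
  defines "b \<equiv> \<lambda>x. unit_vec x - unit_vec z"
  shows "zmod.independent (b ` (UNIV - {z}))" "zmod.span (b ` (UNIV - {z})) = sum_zero"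
    "card (b ` (UNIV - {z})) = card (UNIV :: 'a set) - 1"
proof -
  have b_apply: "b x w = of_bool (w = x)" if "w \<noteq> z" for x w
    using that by (simp add: b_def unit_vec_def)
  have inj: "inj_on b (UNIV - {z})"
  proof (rule inj_onI)
    fix x y assume "x \<in> UNIV - {z}" "y \<in> UNIV - {z}" "b x = b y"
    then show "x = y" using b_apply[of x x] b_apply[of x y] by (simp split: if_splits)
  qed
  then show "card (b ` (UNIV - {z})) = card (UNIV :: 'a set) - 1"
    by (simp add: card_image card_Diff_subset)
  have sum_b: "(\<Sum>x\<in>UNIV - {z}. c x *\<^sub>z b x) w = c w" if "w \<noteq> z" for c w
    using that by (simp add: sum_fun_apply zscale_apply b_apply of_bool_def if_distrib cong: if_cong)
  show "zmod.independent (b ` (UNIV - {z}))"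
    unfolding zmod.dependent_finite[OF finite_imageI[OF finite]]
  proof
    assume "\<exists>u. (\<exists>v\<in>b ` (UNIV - {z}). u v \<noteq> 0) \<and> (\<Sum>v\<in>b ` (UNIV - {z}). u v *\<^sub>z v) = 0"
    then obtain u x where u: "(\<Sum>v\<in>b ` (UNIV - {z}). u v *\<^sub>z v) = 0"
      and x: "u (b x) \<noteq> 0" "x \<noteq> z" by blast
    have "(\<Sum>x\<in>UNIV - {z}. u (b x) *\<^sub>z b x) = 0" using u by (simp add: sum.reindex[OF inj])
    then show False using sum_b[OF x(2), of "\<lambda>x. u (b x)"] x by simp
  qed
  show "zmod.span (b ` (UNIV - {z})) = sum_zero"
  proof (rule zmod.span_subspace)
    show "b ` (UNIV - {z}) \<subseteq> sum_zero"
      by (auto simp: b_def sum_zero_def sum_minus_fun simp del: minus_apply)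
    show "sum_zero \<subseteq> zmod.span (b ` (UNIV - {z}))"
    proof
      fix y :: "'a \<Rightarrow> int" assume y: "y \<in> sum_zero"
      let ?c = "\<Sum>x\<in>UNIV - {z}. y x *\<^sub>z b x"
      have "?c \<in> sum_zero"
        by (intro zmod.subspace_sum[OF subspace_sum_zero] zmod.subspace_scale[OF subspace_sum_zero])
          (use \<open>b ` (UNIV - {z}) \<subseteq> sum_zero\<close> in blast)
      then have 0: "sum (y - ?c) UNIV = 0"
        using y zmod.subspace_diff[OF subspace_sum_zero] by (auto simp: sum_zero_def)
      have eq: "(y - ?c) w = 0" if "w \<noteq> z" for w using sum_b[OF that] by simp
      have "sum (y - ?c) UNIV = (y - ?c) z + sum (y - ?c) (UNIV - {z})"
        by (rule sum.remove) auto
      also have "sum (y - ?c) (UNIV - {z}) = 0" by (rule sum.neutral) (use eq in blast)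
      finally have "(y - ?c) z = 0" using 0 by simp
      then have "y - ?c = 0" using eq by (intro ext) (metis zero_fun_apply)
      then have "y = ?c" by simp
      also have "?c \<in> zmod.span (b ` (UNIV - {z}))"
        by (intro zmod.span_sum zmod.span_scale zmod.span_base) auto
      finally show "y \<in> zmod.span (b ` (UNIV - {z}))" .
    qed
  qed (rule subspace_sum_zero)
qed

text \<open>On the lattice of vectors with coordinate sum \<open>0\<close> the operator \<open>L\<close> satisfies
  \<open>(L - s m) (L - s (m + 1)) = 0\<close> with \<open>q = s\<^sup>2\<close> and \<open>r = m (m + 1)\<close>. In the application \<open>M\<close> is a
  permutation of the coordinates carrying the graph to its complement, so that \<open>L M = M (q - L)\<close>.\<close>

locale conference_laplacian =
  fixes L M :: "('a::finite \<Rightarrow> int) \<Rightarrow> 'a \<Rightarrow> int" and m s q r :: int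
  assumes L_hom: "module_hom zscale zscale L" and M_hom: "module_hom zscale zscale M"
    and L_sum: "sum (L g) UNIV = 0" and L_const: "L (\<lambda>_. c) = 0"
    and L_square: "y \<in> sum_zero \<Longrightarrow> L (L y) = q *\<^sub>z L y - (q * r) *\<^sub>z y"
    and M_bij: "bij M" and M_sum: "sum (M g) UNIV = sum g UNIV"
    and L_M: "y \<in> sum_zero \<Longrightarrow> L (M y) = q *\<^sub>z M y - M (L y)"
    and card_eq: "int (card (UNIV :: 'a set)) = q"
    and m_pos: "m > 0" and s_eq: "s = 2 * m + 1" and q_eq: "q = s\<^sup>2" and r_eq: "r = m * (m + 1)"
begin

sublocale L: module_hom zscale zscale L by (rule L_hom)
sublocale M: module_hom zscale zscale M by (rule M_hom)

definition eig :: "int \<Rightarrow> ('a \<Rightarrow> int) set" where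
  "eig c = {y \<in> sum_zero. L y = c *\<^sub>z y}"

text \<open>Since \<open>m\<close> is \<open>(s - 1) / 2\<close>, these are the eigenlattices for
  the values a and b of the overview.\<close>

abbreviation "Ep \<equiv> eig (s * m)"
abbreviation "Em \<equiv> eig (s * (m + 1))"

lemma q_eq': "q = 4 * r + 1" and r_pos: "r > 0" and s_pos: "s > 0"
  using m_pos by (simp_all add: q_eq r_eq s_eq power2_eq_square algebra_simps add_pos_pos)

lemma q_pos: "q > 0"
  using q_eq' r_pos by simp

text \<open>The two eigenvalues are the roots of T^2 - q T + q r, the polynomial behind
  \<open>L_square\<close>.\<close>

lemma eig_sum: "s * m + s * (m + 1) = q" and eig_prod: "s * m * (s * (m + 1)) = q * r"
  by (simp_all add: q_eq r_eq s_eq power2_eq_square algebra_simps)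

lemma subspace_eig: "zmod.subspace (eig c)"
proof (rule zmod.subspaceI)
  show "0 \<in> eig c" using zmod.subspace_0[OF subspace_sum_zero] by (simp add: eig_def)
  show "x + y \<in> eig c" if "x \<in> eig c" "y \<in> eig c" for x y
    using that zmod.subspace_add[OF subspace_sum_zero] by (auto simp: eig_def L.add zmod.scale_right_distrib)
  show "k *\<^sub>z x \<in> eig c" if "x \<in> eig c" for k x
    using that zmod.subspace_scale[OF subspace_sum_zero] by (auto simp: eig_def L.scale mult.commute)
qed

lemma zscale_cancel: "c *\<^sub>z y = c *\<^sub>z y' \<longleftrightarrow> c = 0 \<or> y = y'"
  by (auto simp: fun_eq_iff zscale_apply)

lemma zscale_eq_0_iff: "c *\<^sub>z y = 0 \<longleftrightarrow> c = 0 \<or> y = 0"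
  by (auto simp: fun_eq_iff zscale_apply)

lemma eig_Int: "x = 0" if "x \<in> Ep" "x \<in> Em" for x
proof -
  have "(s * (m + 1)) *\<^sub>z x = (s * m) *\<^sub>z x" using that by (simp add: eig_def)
  then have "\<forall>t. s * (m + 1) * x t = s * m * x t" by (simp add: fun_eq_iff zscale_apply)
  then show ?thesis using s_pos by (auto simp: algebra_simps fun_eq_iff)
qed

text \<open>By \<open>L_M\<close>, \<open>M\<close> turns an eigenvalue c into q - c, and the two
  eigenvalues add up to \<open>q\<close>. Bijectivity of \<open>M\<close> on the whole space makes
  it onto \<open>Em\<close>.\<close>

lemma M_eig: "M ` Ep = Em"
proof -
  have M_Ep: "L (M v) = (s * (m + 1)) *\<^sub>z M v \<longleftrightarrow> L v = (s * m) *\<^sub>z v" if "v \<in> sum_zero" for v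
  proof -
    have cancel: "(c + d) *\<^sub>z w - z = d *\<^sub>z w \<longleftrightarrow> z = c *\<^sub>z w" for c d and w z :: "'a \<Rightarrow> int"
      by (auto simp: fun_eq_iff zscale_apply algebra_simps)
    have "L (M v) = (s * (m + 1)) *\<^sub>z M v \<longleftrightarrow> M (L v) = (s * m) *\<^sub>z M v"
      unfolding L_M[OF that] eig_sum[symmetric] by (rule cancel)
    also have "\<dots> \<longleftrightarrow> M (L v) = M ((s * m) *\<^sub>z v)" by (simp add: M.scale)
    finally show ?thesis using M_bij by (simp add: bij_is_inj inj_eq)
  qed
  have M_Y: "M v \<in> sum_zero \<longleftrightarrow> v \<in> sum_zero" for v by (simp add: sum_zero_def M_sum)
  show ?thesis
  proof (intro equalityI subsetI)
    show "w \<in> Em" if "w \<in> M ` Ep" for w using that M_Ep M_Y by (auto simp: eig_def)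
    fix w assume w: "w \<in> Em"
    obtain v where "w = M v" using M_bij by (metis bij_pointE)
    then show "w \<in> M ` Ep" using w M_Ep M_Y by (auto simp: eig_def)
  qed
qed

lemma L_in_sum_zero: "L g \<in> sum_zero"
  by (simp add: sum_zero_def L_sum)

text \<open>The quadratic relation solved for its constant term: \<open>q * r\<close> annihilates
  \<open>Y\<close> modulo \<open>L Y\<close>. Injectivity of \<open>L\<close> on \<open>Y\<close>
  and the torsion of the cokernel both follow from it.\<close>

lemma exponent: "y \<in> sum_zero \<Longrightarrow> (q * r) *\<^sub>z y = L (q *\<^sub>z y - L y)"
  by (simp add: L.diff L.scale L_square)

lemma inj_L: "inj_on L sum_zero"
proof (rule inj_onI)
  fix x y assume "x \<in> sum_zero" "y \<in> sum_zero" "L x = L y"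
  then have d: "x - y \<in> sum_zero" "L (x - y) = 0"
    using zmod.subspace_diff[OF subspace_sum_zero] by (auto simp: L.diff)
  then have "(q * r) *\<^sub>z (x - y) = 0" using exponent[OF d(1)] by (simp only: L.scale L.diff) simp
  then show "x = y" using q_pos r_pos by (simp add: zscale_eq_0_iff)
qed

text \<open>With eigenvalues a and b, the vectors (b - L) y and (L - a) y are eigenvectors for a and
  b because (L - a) (L - b) = 0 on \<open>Y\<close>. They sum to (b - a) y, and b - a is
  \<open>s\<close>.\<close>

lemma eig_decomposition:
  assumes "y \<in> sum_zero"
  obtains v w where "v \<in> Ep" "w \<in> Em" "s *\<^sub>z y = v + w"
proof
  let ?v = "(s * (m + 1)) *\<^sub>z y - L y" and ?w = "L y - (s * m) *\<^sub>z y"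
  have qr: "(q * r) *\<^sub>z y = (s * m * (s * (m + 1))) *\<^sub>z y" by (simp only: eig_prod)
  have q: "q *\<^sub>z L y = (s * m + s * (m + 1)) *\<^sub>z L y" by (simp only: eig_sum)
  have Y: "?v \<in> sum_zero" "?w \<in> sum_zero"
    using assms L_in_sum_zero zmod.subspace_diff[OF subspace_sum_zero] zmod.subspace_scale[OF subspace_sum_zero]
    by blast+
  have "L ?v = (s * m) *\<^sub>z ?v"
    unfolding L.diff L.scale L_square[OF assms] qr q
    by (simp add: fun_eq_iff zscale_apply algebra_simps)
  then show "?v \<in> Ep" using Y by (simp add: eig_def)
  have "L ?w = (s * (m + 1)) *\<^sub>z ?w"
    unfolding L.diff L.scale L_square[OF assms] qr q
    by (simp add: fun_eq_iff zscale_apply algebra_simps)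
  then show "?w \<in> Em" using Y by (simp add: eig_def)
  show "s *\<^sub>z y = ?v + ?w" by (simp add: fun_eq_iff zscale_apply algebra_simps)
qed

lemma scale_hom: "module_hom zscale zscale ((*\<^sub>z) k :: ('a \<Rightarrow> int) \<Rightarrow> _)"
  by (rule zmod.module_hom_scale_self)

lemma index_scale_sum_zero:
  assumes "k > 0"
  shows "int (add_index sum_zero ((*\<^sub>z) k ` (sum_zero :: ('a \<Rightarrow> int) set))) = k ^ (card (UNIV :: 'a set) - 1)"
proof -
  fix z :: 'a
  let ?B = "(\<lambda>x. unit_vec x - unit_vec z) ` (UNIV - {z})"
  have "int (add_index (zmod.span ?B) ((*\<^sub>z) k ` zmod.span ?B)) = (\<Prod>v\<in>?B. k)"
    using assms by (intro index_diagonal scale_hom sum_zero_basis) auto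
  then show ?thesis by (simp only: sum_zero_basis prod_constant)
qed

lemma eig_sum_basis:
  assumes B: "finite B" "zmod.independent B" "zmod.span B = Ep"
  shows "zmod.independent (B \<union> M ` B)" "B \<inter> M ` B = {}"
    "zmod.span (B \<union> M ` B) = {v + w | v w. v \<in> Ep \<and> w \<in> Em}"
proof -
  have spanM: "zmod.span (M ` B) = Em" using M.span_image[of B] M_eig B(3) by simp
  then show "zmod.span (B \<union> M ` B) = {v + w | v w. v \<in> Ep \<and> w \<in> Em}"
    using zmod.span_Un[of B "M ` B"] B(3) by auto
  have indM: "zmod.independent (M ` B)"
    using M.independent_injective_image[OF B(2)] M_bij by (metis bij_is_inj inj_on_subset subset_UNIV)
  have sub: "B \<subseteq> Ep" "M ` B \<subseteq> Em"
    using zmod.span_superset[of B] zmod.span_superset[of "M ` B"] by (simp_all only: B(3) spanM)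
  show disj: "B \<inter> M ` B = {}"
  proof (rule ccontr)
    assume "B \<inter> M ` B \<noteq> {}"
    then obtain x where x: "x \<in> B" "x \<in> M ` B" by blast
    then have "x = 0" using sub eig_Int by blast
    then show False using x(1) zmod.dependent_zero B(2) by blast
  qed
  show "zmod.independent (B \<union> M ` B)"
    unfolding zmod.dependent_finite[OF finite_UnI[OF B(1) finite_imageI[OF B(1)]]]
  proof
    assume "\<exists>u. (\<exists>v\<in>B \<union> M ` B. u v \<noteq> 0) \<and> (\<Sum>v\<in>B \<union> M ` B. u v *\<^sub>z v) = 0"
    then obtain u v where v: "v \<in> B \<union> M ` B" "u v \<noteq> 0" and u: "(\<Sum>v\<in>B \<union> M ` B. u v *\<^sub>z v) = 0"
      by blast
    let ?x = "\<Sum>v\<in>B. u v *\<^sub>z v" and ?y = "\<Sum>v\<in>M ` B. u v *\<^sub>z v"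
    have xy: "?x + ?y = 0" using u disj B(1) by (simp add: sum.union_disjoint)
    have x: "?x \<in> Ep"
      by (intro zmod.subspace_sum[OF subspace_eig] zmod.subspace_scale[OF subspace_eig])
        (use sub in blast)
    have y: "?y \<in> Em"
      by (intro zmod.subspace_sum[OF subspace_eig] zmod.subspace_scale[OF subspace_eig])
        (use sub in blast)
    have "?x = - ?y" using xy by (simp add: eq_neg_iff_add_eq_0)
    then have "?x \<in> Em" using zmod.subspace_neg[OF subspace_eig y] by simp
    then have x0: "?x = 0" using x eig_Int by blast
    then have y0: "?y = 0" using xy by simp
    show False
      using v zmod.independentD[OF B(2,1) order_refl x0]
        zmod.independentD[OF indM finite_imageI[OF B(1)] order_refl y0] by blast
  qed
qed

text \<open>Only constant vectors are killed by \<open>L\<close>: \<open>q\<close> times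
  \<open>g\<close>, minus the constant \<open>sum g UNIV\<close>, has coordinate sum 0 and lies in
  the kernel, so it vanishes by \<open>inj_L\<close>.\<close>

lemma L_kernel: "L g = 0 \<Longrightarrow> q * g x = sum g UNIV"
proof -
  assume "L g = 0"
  let ?y = "q *\<^sub>z g - (\<lambda>_. sum g UNIV)"
  have "?y \<in> sum_zero"
    using card_eq by (simp add: sum_zero_def sum_subtractf sum_zscale)
  moreover have "L ?y = L 0" using \<open>L g = 0\<close> by (simp add: L.diff L.scale L_const)
  moreover have "0 \<in> sum_zero" by (rule zmod.subspace_0[OF subspace_sum_zero])
  ultimately have "?y = 0" using inj_L by (meson inj_onD)
  then have "?y x = 0" by simp
  then show ?thesis by (simp add: zscale_apply)
qed

text \<open>Modulo \<open>Y\<close> a vector is determined by its coordinate sum, and the kernel of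
  \<open>L\<close> consists of constants, whose sums are multiples of \<open>q\<close>. The images
  of \<open>j\<close> times a unit vector with \<open>0 \<le> j < q\<close> thus represent the
  cosets.\<close>

lemma index_range_L: "int (add_index (range L) (L ` sum_zero)) = q"
proof -
  fix z :: 'a
  define \<delta> where "\<delta> j = L (j *\<^sub>z unit_vec z)" for j
  have K: "zmod.subspace (L ` sum_zero)" by (simp add: L.subspace_image subspace_sum_zero)
  have "bij_betw (\<lambda>j. (+) (\<delta> j) ` (L ` sum_zero)) {0..<q} (add_cosets (range L) (L ` sum_zero))"
  proof (rule bij_betwI')
    fix j k assume jk: "j \<in> {0..<q}" "k \<in> {0..<q}"
    show "(+) (\<delta> j) ` (L ` sum_zero) = (+) (\<delta> k) ` (L ` sum_zero) \<longleftrightarrow> j = k"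
    proof
      assume "(+) (\<delta> j) ` (L ` sum_zero) = (+) (\<delta> k) ` (L ` sum_zero)"
      then have "\<delta> j - \<delta> k \<in> L ` sum_zero" using coset_eq_iff[OF K] by blast
      then obtain y where y: "y \<in> sum_zero" "\<delta> j - \<delta> k = L y" by blast
      let ?g = "j *\<^sub>z unit_vec z - k *\<^sub>z unit_vec z - y"
      have "L ?g = 0" using y by (simp add: L.diff \<delta>_def)
      then have "q * ?g z = sum ?g UNIV" by (rule L_kernel)
      also have "\<dots> = j - k"
        using y(1) by (simp add: sum_zero_def sum_minus_fun sum_zscale del: minus_apply)
      finally have "q dvd j - k" by (metis dvd_triv_left)
      then have "j mod q = k mod q" by (simp add: mod_eq_dvd_iff)
      then show "j = k" using jk by simp
    qed auto
  next
    fix j show "(+) (\<delta> j) ` (L ` sum_zero) \<in> add_cosets (range L) (L ` sum_zero)"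
      by (auto simp: add_cosets_def \<delta>_def)
  next
    fix Z assume "Z \<in> add_cosets (range L) (L ` sum_zero)"
    then obtain g where g: "Z = (+) (L g) ` (L ` sum_zero)" by (auto simp: add_cosets_def)
    define j k where "j = sum g UNIV mod q" and "k = sum g UNIV div q"
    have jk: "sum g UNIV = j + k * q" by (simp add: j_def k_def)
    \<comment> \<open>Subtracting the constant \<open>k\<close> is invisible to \<open>L\<close> and
      lowers the coordinate sum by \<open>k * q\<close>, which leaves 0.\<close>
    let ?y = "g - j *\<^sub>z unit_vec z - (\<lambda>_. k)"
    have "?y \<in> sum_zero"
      using jk card_eq by (simp add: sum_zero_def sum_minus_fun sum_zscale mult.commute del: minus_apply)
    moreover have "L g - \<delta> j = L ?y" by (simp add: \<delta>_def L.diff L_const)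
    ultimately have "L g - \<delta> j \<in> L ` sum_zero" by blast
    then have "Z = (+) (\<delta> j) ` (L ` sum_zero)" using g coset_eq_iff[OF K] by blast
    moreover have "j \<in> {0..<q}" using q_pos by (simp add: j_def)
    ultimately show "\<exists>j\<in>{0..<q}. Z = (+) (\<delta> j) ` (L ` sum_zero)" by blast
  qed
  then have "add_index (range L) (L ` sum_zero) = card {0..<q}"
    unfolding add_index_def by (rule bij_betw_same_card[symmetric])
  then show ?thesis using q_pos by simp
qed

theorem index_and_basis:
  obtains B where "finite B" "zmod.span B = Ep" "card B = nat (2 * r)"
    "int (add_index sum_zero (range L)) * q = (q * r) ^ nat (2 * r)"
proof -
  obtain B where B: "finite B" "zmod.independent B" "zmod.span B = Ep"
    using subspace_has_basis[OF subspace_eig] by blast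
  note E = eig_sum_basis[OF B]
  let ?E = "zmod.span (B \<union> M ` B)"
  have EY: "?E \<subseteq> sum_zero"
    unfolding E(3) using zmod.subspace_add[OF subspace_sum_zero] by (auto simp: eig_def)
  have card_MB: "card (M ` B) = card B"
    using M_bij by (meson bij_is_inj card_image inj_on_subset subset_UNIV)
  have fin: "finite (B \<union> M ` B)" using B by simp
  have sub: "B \<subseteq> Ep" "M ` B \<subseteq> Em"
    using zmod.span_superset[of B] M_eig B(3) by blast+
  \<comment> \<open>\<open>s Y\<close> lies in \<open>E\<close> and has nonzero index in
    \<open>Y\<close>; that index is a multiple of [Y : E].\<close>
  have pos: "add_index sum_zero ?E > 0"
  proof -
    have "(*\<^sub>z) s ` sum_zero \<subseteq> ?E"
      unfolding E(3) by (auto elim!: eig_decomposition)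
    then have "add_index sum_zero ((*\<^sub>z) s ` (sum_zero :: ('a \<Rightarrow> int) set))
        = add_index sum_zero ?E * add_index ?E ((*\<^sub>z) s ` sum_zero)"
      by (intro index_tower EY)
        (auto simp: subspace_sum_zero module_hom.subspace_image[OF scale_hom subspace_sum_zero])
    then show ?thesis
      using index_scale_sum_zero[OF s_pos] s_pos by (metis gr0I mult_zero_left of_nat_0 power_not_zero less_irrefl)
  qed
  \<comment> \<open>Doubling serves as a probe for the rank: its index on a lattice of rank n is
    2^n, and it is the same on \<open>Y\<close> as on the sublattice \<open>E\<close> of finite
    index. Hence q - 1 is twice the size of \<open>B\<close>.\<close>
  have two: "add_index sum_zero ((*\<^sub>z) 2 ` (sum_zero :: ('a \<Rightarrow> int) set)) = add_index ?E ((*\<^sub>z) 2 ` ?E)"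
    by (rule index_image_commensurable[OF scale_hom _ subspace_sum_zero zmod.subspace_span EY _ _ pos])
      (auto simp: inj_on_def zscale_cancel zmod.subspace_scale[OF subspace_sum_zero] zmod.span_scale)
  moreover have "int (add_index ?E ((*\<^sub>z) 2 ` ?E)) = (\<Prod>v\<in>B \<union> M ` B. 2)"
    by (rule index_diagonal[OF scale_hom fin E(1)]) auto
  moreover have "card (B \<union> M ` B) = 2 * card B"
    using card_Un_disjoint[OF B(1) finite_imageI[OF B(1)] E(2)] card_MB by simp
  ultimately have "(2::int) ^ (card (UNIV :: 'a set) - 1) = 2 ^ (2 * card B)"
    using index_scale_sum_zero[of 2] by simp
  then have "card (UNIV :: 'a set) - 1 = 2 * card B" by simp
  then have card_B: "card B = nat (2 * r)" using card_eq q_eq' by linarith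
  have L_E: "L ` ?E \<subseteq> ?E"
  proof -
    have "L ` Ep \<subseteq> Ep" "L ` Em \<subseteq> Em"
      using zmod.subspace_scale[OF subspace_eig] by (auto simp: eig_def)
    then show ?thesis unfolding E(3) by (fastforce simp: L.add)
  qed
  \<comment> \<open>On \<open>E\<close> the operator is diagonal. Each \<open>v\<close> in
    \<open>B\<close> pairs with \<open>M v\<close>, and the two eigenvalues multiply to
    \<open>q * r\<close>.\<close>
  have "add_index sum_zero (L ` sum_zero) = add_index ?E (L ` ?E)"
    by (rule index_image_commensurable[OF L_hom inj_L subspace_sum_zero zmod.subspace_span EY _ L_E pos])
      (auto simp: L_in_sum_zero)
  moreover have "int (add_index ?E (L ` ?E)) = (\<Prod>v\<in>B \<union> M ` B. if v \<in> B then s * m else s * (m + 1))"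
    by (rule index_diagonal[OF L_hom fin E(1)]) (use sub s_pos m_pos in \<open>auto simp: eig_def\<close>)
  moreover have "\<dots> = (q * r) ^ card B"
  proof -
    have "(\<Prod>v\<in>M ` B. if v \<in> B then s * m else s * (m + 1)) = (\<Prod>v\<in>M ` B. s * (m + 1))"
      using E(2) by (intro prod.cong) auto
    then have "(\<Prod>v\<in>B \<union> M ` B. if v \<in> B then s * m else s * (m + 1))
        = (\<Prod>v\<in>B. s * m) * (\<Prod>v\<in>M ` B. s * (m + 1))"
      using B(1) E(2) by (simp add: prod.union_disjoint)
    then show ?thesis using card_MB eig_prod by (simp add: power_mult_distrib[symmetric])
  qed
  moreover have "add_index sum_zero (L ` sum_zero)
      = add_index sum_zero (range L) * add_index (range L) (L ` sum_zero)"
    by (rule index_tower) (auto simp: subspace_sum_zero L.subspace_image L_in_sum_zero)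
  ultimately have "int (add_index sum_zero (range L)) * q = (q * r) ^ card B"
    using index_range_L by (metis of_nat_mult)
  then show ?thesis using that B card_B by auto
qed

end

section \<open>The critical group\<close>

lemma carrier_int_vectors_UNIV: "carrier (int_vectors (UNIV :: 'v set)) = UNIV"
  by (simp add: int_vectors_def)

lemma mult_int_vectors_UNIV: "x \<otimes>\<^bsub>int_vectors UNIV\<^esub> y = x + y"
  by (simp add: int_vectors_def plus_fun_def restrict_def)

lemma one_int_vectors_UNIV: "\<one>\<^bsub>int_vectors UNIV\<^esub> = 0"
  by (simp add: int_vectors_def zero_fun_def restrict_def)

lemma comm_group_int_vectors_UNIV: "comm_group (int_vectors UNIV)"
proof (rule comm_groupI)
  fix x :: "'v \<Rightarrow> int"
  have "- x \<otimes>\<^bsub>int_vectors UNIV\<^esub> x = \<one>\<^bsub>int_vectors UNIV\<^esub>"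
    by (simp add: mult_int_vectors_UNIV one_int_vectors_UNIV)
  then show "\<exists>y\<in>carrier (int_vectors UNIV). y \<otimes>\<^bsub>int_vectors UNIV\<^esub> x = \<one>\<^bsub>int_vectors UNIV\<^esub>"
    by (auto simp: carrier_int_vectors_UNIV)
qed (simp_all add: carrier_int_vectors_UNIV mult_int_vectors_UNIV one_int_vectors_UNIV ac_simps)

lemma r_coset_int_vectors_UNIV: "N #>\<^bsub>int_vectors UNIV\<^esub> x = (+) x ` N"
  by (auto simp: r_coset_def mult_int_vectors_UNIV add.commute)

lemma subgroup_int_vectors_UNIV:
  assumes "zmod.subspace N"
  shows "subgroup N (int_vectors UNIV)"
proof -
  interpret G: comm_group "int_vectors (UNIV :: 'a set)" by (rule comm_group_int_vectors_UNIV)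
  show ?thesis
  proof (rule G.subgroupI)
    show "N \<noteq> {}" using zmod.subspace_0[OF assms] by blast
    fix x assume x: "x \<in> N"
    have "inv\<^bsub>int_vectors UNIV\<^esub> x = - x"
      by (rule G.inv_equality)
        (simp_all add: carrier_int_vectors_UNIV mult_int_vectors_UNIV one_int_vectors_UNIV)
    then show "inv\<^bsub>int_vectors UNIV\<^esub> x \<in> N" using zmod.subspace_neg[OF assms x] by simp
    fix y assume "y \<in> N"
    then show "x \<otimes>\<^bsub>int_vectors UNIV\<^esub> y \<in> N"
      using zmod.subspace_add[OF assms x] by (simp add: mult_int_vectors_UNIV)
  qed (simp add: carrier_int_vectors_UNIV)
qed

locale conference_critical_group = conference_laplacian +
  fixes \<Gamma> :: "'a pair_pre_digraph" and p e :: nat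
  assumes verts: "pverts \<Gamma> = UNIV" and L_eq: "laplacian_map \<Gamma> = L"
    and p: "Factorial_Ring.prime p" and q_pow: "q = int p ^ e"
begin

section \<open>The critical group as \<open>Y\<close> modulo the image of \<open>L\<close>\<close>

definition cls :: "('a \<Rightarrow> int) \<Rightarrow> ('a \<Rightarrow> int) set" where
  "cls g = (+) g ` range L"

abbreviation "K \<equiv> critical_group \<Gamma>"

lemma subspace_range_L: "zmod.subspace (range L)"
  by (simp add: L.subspace_image)

lemma cls_eq_iff: "cls g = cls h \<longleftrightarrow> g - h \<in> range L"
  unfolding cls_def by (rule coset_eq_iff[OF subspace_range_L])

lemma cls_eqI: "g = h + L x \<Longrightarrow> cls g = cls h"
  by (simp add: cls_eq_iff)

lemma range_L_normal: "range L \<lhd> int_vectors UNIV"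
  using comm_group.subgroup_imp_normal[OF comm_group_int_vectors_UNIV]
    subgroup_int_vectors_UNIV[OF subspace_range_L] by blast

lemma cokernel: "laplacian_cokernel \<Gamma> = int_vectors UNIV Mod range L"
  by (simp add: laplacian_cokernel_def verts L_eq carrier_int_vectors_UNIV)

lemma K_simps: "carrier K = torsion_subgroup (laplacian_cokernel \<Gamma>)"
  "x \<otimes>\<^bsub>K\<^esub> y = x <#>\<^bsub>int_vectors UNIV\<^esub> y" "\<one>\<^bsub>K\<^esub> = range L"
  by (simp_all add: critical_group_def cokernel)

lemma K_mult: "cls g \<otimes>\<^bsub>K\<^esub> cls h = cls (g + h)"
  using normal.rcos_sum[OF range_L_normal, of g h]
  by (simp add: K_simps cls_def r_coset_int_vectors_UNIV carrier_int_vectors_UNIV mult_int_vectors_UNIV)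

lemma K_one: "\<one>\<^bsub>K\<^esub> = cls 0"
  by (auto simp: K_simps cls_def)

lemma cokernel_pow: "cls g [^]\<^bsub>laplacian_cokernel \<Gamma>\<^esub> n = cls (int n *\<^sub>z g)"
proof -
  have "g [^]\<^bsub>int_vectors UNIV\<^esub> n = int n *\<^sub>z g"
    by (induction n) (simp_all add: nat_pow_def one_int_vectors_UNIV mult_int_vectors_UNIV
      zmod.scale_left_distrib add.commute)
  then show ?thesis
    using normal.FactGroup_pow[OF range_L_normal, of g n]
    by (simp add: cokernel cls_def r_coset_int_vectors_UNIV carrier_int_vectors_UNIV)
qed

lemma K_pow: "cls g [^]\<^bsub>K\<^esub> n = cls (int n *\<^sub>z g)"
proof -
  have "cls g [^]\<^bsub>K\<^esub> n = cls g [^]\<^bsub>laplacian_cokernel \<Gamma>\<^esub> n"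
    by (simp add: nat_pow_def critical_group_def)
  then show ?thesis by (simp add: cokernel_pow)
qed

lemma scale_range_L: "x \<in> range L \<Longrightarrow> c *\<^sub>z x \<in> range L"
  by (rule zmod.subspace_scale[OF subspace_range_L])

lemma exponent_range_L: "y \<in> sum_zero \<Longrightarrow> (q * r) *\<^sub>z y \<in> range L"
  using exponent by blast

text \<open>Vectors in the image of \<open>L\<close> have coordinate sum 0, so a torsion class must
  come from \<open>Y\<close>; conversely \<open>q * r\<close> kills every class of
  \<open>Y\<close>.\<close>

lemma K_carrier: "carrier K = cls ` sum_zero"
proof -
  have car: "carrier (laplacian_cokernel \<Gamma>) = range cls"
    by (simp add: cokernel carrier_FactGroup cls_def r_coset_int_vectors_UNIV carrier_int_vectors_UNIV)
  have one: "\<one>\<^bsub>laplacian_cokernel \<Gamma>\<^esub> = cls 0" by (auto simp: cokernel cls_def)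
  have "(\<exists>n::nat. n > 0 \<and> int n *\<^sub>z g \<in> range L) \<longleftrightarrow> g \<in> sum_zero" for g
  proof
    assume "\<exists>n::nat. n > 0 \<and> int n *\<^sub>z g \<in> range L"
    then obtain n :: nat where n: "n > 0" "int n *\<^sub>z g \<in> range L" by blast
    then have "sum (int n *\<^sub>z g) UNIV = 0" using L_in_sum_zero by (auto simp: sum_zero_def)
    then show "g \<in> sum_zero" using n(1) by (simp add: sum_zscale sum_zero_def)
  next
    assume "g \<in> sum_zero"
    then have "int (nat (q * r)) *\<^sub>z g \<in> range L" using exponent_range_L q_pos r_pos by simp
    moreover have "nat (q * r) > 0" using q_pos r_pos by simp
    ultimately show "\<exists>n::nat. n > 0 \<and> int n *\<^sub>z g \<in> range L" by blast
  qed
  then have "cls g \<in> torsion_subgroup (laplacian_cokernel \<Gamma>) \<longleftrightarrow> g \<in> sum_zero" for g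
    unfolding torsion_subgroup_def car one by (simp add: cokernel_pow cls_eq_iff rangeI)
  moreover have "torsion_subgroup (laplacian_cokernel \<Gamma>) \<subseteq> range cls"
    unfolding torsion_subgroup_def car by blast
  ultimately show ?thesis unfolding K_simps by blast
qed

lemma cls_mem: "y \<in> sum_zero \<Longrightarrow> cls y \<in> carrier K"
  by (simp add: K_carrier)

lemma K_comm_group: "comm_group K"
proof (rule comm_groupI)
  fix x y assume "x \<in> carrier K" "y \<in> carrier K"
  then obtain g h where gh: "g \<in> sum_zero" "h \<in> sum_zero" "x = cls g" "y = cls h"
    unfolding K_carrier by blast
  then show "x \<otimes>\<^bsub>K\<^esub> y \<in> carrier K"
    by (simp add: K_mult cls_mem zmod.subspace_add[OF subspace_sum_zero])
  show "x \<otimes>\<^bsub>K\<^esub> y = y \<otimes>\<^bsub>K\<^esub> x" using gh by (simp add: K_mult add.commute)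
next
  fix x assume "x \<in> carrier K"
  then obtain g where g: "g \<in> sum_zero" "x = cls g" unfolding K_carrier by blast
  then have "cls (- g) \<in> carrier K" "cls (- g) \<otimes>\<^bsub>K\<^esub> x = \<one>\<^bsub>K\<^esub>"
    by (simp_all add: cls_mem K_mult K_one zmod.subspace_neg[OF subspace_sum_zero])
  then show "\<exists>y\<in>carrier K. y \<otimes>\<^bsub>K\<^esub> x = \<one>\<^bsub>K\<^esub>" by blast
next
  show "\<one>\<^bsub>K\<^esub> \<in> carrier K"
    unfolding K_one by (rule cls_mem) (rule zmod.subspace_0[OF subspace_sum_zero])
next
  fix x y z assume "x \<in> carrier K" "y \<in> carrier K" "z \<in> carrier K"
  then obtain f g h where "x = cls f" "y = cls g" "z = cls h" unfolding K_carrier by blast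
  then show "x \<otimes>\<^bsub>K\<^esub> y \<otimes>\<^bsub>K\<^esub> z = x \<otimes>\<^bsub>K\<^esub> (y \<otimes>\<^bsub>K\<^esub> z)" by (simp only: K_mult add.assoc)
next
  fix x assume "x \<in> carrier K"
  then obtain f where "x = cls f" unfolding K_carrier by blast
  then show "\<one>\<^bsub>K\<^esub> \<otimes>\<^bsub>K\<^esub> x = x" by (simp only: K_mult K_one add_0_left)
qed

text \<open>The order is [Y : L Z^V]; the exponent drops by one upon cancelling the factor
  [L Z^V : L Y] = q.\<close>

lemma card_K: "int (card (carrier K)) = q ^ (nat (2 * r) - 1) * r ^ nat (2 * r)"
proof -
  have D: "nat (2 * r) = Suc (nat (2 * r) - 1)" using r_pos by simp
  have "card (carrier K) = add_index sum_zero (range L)"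
    by (simp add: K_carrier add_index_def add_cosets_def cls_def[abs_def])
  then have "int (card (carrier K)) * q = (q * r) ^ nat (2 * r)"
    using index_and_basis by metis
  also have "\<dots> = q ^ Suc (nat (2 * r) - 1) * r ^ nat (2 * r)"
    using D by (simp only: power_mult_distrib)
  finally show ?thesis using q_pos by simp
qed

theorem critical_group_structure:
  assumes dec: "sylow_decomposition p K P Q"
  shows "K\<lparr>carrier := Q\<rparr> \<cong> product_group {..<nat (2 * r)} (\<lambda>_. integer_mod_group (nat r))"
    and "int (card P) = q ^ (nat (2 * r) - 1)"
proof -
  interpret K: comm_group K by (rule K_comm_group)
  define D where "D = nat (2 * r)"
  define R where "R = nat r"
  have R: "int R = r" "R > 0" using r_pos by (simp_all add: R_def)
  have D: "D > 0" using r_pos by (simp add: D_def)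
  have "int (card (carrier K)) = int (p ^ (e * (D - 1)) * R ^ D)"
    by (simp add: card_K q_pow R D_def[symmetric] power_mult)
  then have order: "Coset.order K = p ^ (e * (D - 1)) * R ^ D"
    unfolding Coset.order_def by (simp only: of_nat_eq_iff)
  \<comment> \<open>\<open>p\<close> divides \<open>q = 4 * r + 1\<close> and hence cannot divide
    \<open>r\<close>.\<close>
  have "\<not> p dvd R ^ D"
  proof
    assume "p dvd R ^ D"
    then have "int p dvd r" using p R prime_dvd_power by (metis int_dvd_int_iff)
    moreover have "e > 0" using q_eq' r_pos q_pow by (cases e) auto
    then have "int p dvd q" using q_pow by simp
    ultimately have "int p dvd q - 4 * r" by simp
    then have "int p dvd 1" using q_eq' by simp
    then show False using p by simp
  qed
  note compl = K.sylow_decomposition_complement[OF dec order p this]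
  show "int (card P) = q ^ (nat (2 * r) - 1)"
    using compl(1) by (simp add: q_pow power_mult D_def)
  have Q_iff: "cls y \<in> Q \<longleftrightarrow> (r ^ D) *\<^sub>z y \<in> range L" if "y \<in> sum_zero" for y
    using cls_mem[OF that] by (simp add: compl(3) K_pow K_one cls_eq_iff R)
  \<comment> \<open>Both \<open>q * r\<close> and \<open>r ^ D\<close> kill the class of
    \<open>y\<close>. As \<open>q\<close> and \<open>r\<close> are coprime, the greatest common
    divisor of these two numbers is \<open>r\<close>.\<close>
  have r_Q: "r *\<^sub>z y \<in> range L" if y: "y \<in> sum_zero" "cls y \<in> Q" for y
  proof -
    have "coprime q r"
    proof (rule coprimeI)
      fix c assume "c dvd q" "c dvd r"
      then have "c dvd q - 4 * r" by simp
      then show "is_unit c" by (simp add: q_eq')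
    qed
    then have "coprime q (r ^ (D - 1))" by simp
    then obtain u w where "u * q + w * r ^ (D - 1) = 1" by (metis bezout_int coprime_imp_gcd_eq_1)
    then have "r = (u * q + w * r ^ (D - 1)) * r" by simp
    also have "\<dots> = u * (q * r) + w * r ^ D"
      using D by (simp add: algebra_simps power_eq_if)
    finally have "r *\<^sub>z y = u *\<^sub>z ((q * r) *\<^sub>z y) + w *\<^sub>z ((r ^ D) *\<^sub>z y)"
      by (metis zmod.scale_left_distrib zmod.scale_scale)
    also have "\<dots> \<in> range L"
      using scale_range_L[OF exponent_range_L[OF y(1)], of u]
        scale_range_L[OF iffD1[OF Q_iff[OF y(1)] y(2)], of w]
      by (rule zmod.subspace_add[OF subspace_range_L])
    finally show ?thesis .
  qed
  obtain B where B: "finite B" "zmod.span B = Ep" "card B = D"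
    unfolding D_def by (rule index_and_basis)
  obtain b where b: "bij_betw b {..<D} B"
    using ex_bij_betw_nat_finite[OF B(1)] B(3) by (auto simp: lessThan_atLeast0)
  \<comment> \<open>The classes of \<open>q (v + M v)\<close>, for \<open>v\<close> in a basis of \<open>Ep\<close>, generate \<open>Q\<close>: modulo the image of \<open>L\<close>
    the vector \<open>q s v\<close> has order dividing \<open>m\<close>, and \<open>q s M v\<close> has order dividing the coprime \<open>m + 1\<close>.\<close>
  define comb where "comb c = (\<Sum>i<D. c i *\<^sub>z (q *\<^sub>z (b i + M (b i))))" for c :: "nat \<Rightarrow> int"
  have Ep_Y: "v + M v \<in> sum_zero" if "v \<in> Ep" for v
    using that M_sum zmod.subspace_add[OF subspace_sum_zero] by (simp add: eig_def sum_zero_def)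
  have b_Ep: "b i \<in> Ep" if "i < D" for i
    using that b B(2) zmod.span_base bij_betwE by (metis lessThan_iff)
  have comb_Y: "comb c \<in> sum_zero" for c
    unfolding comb_def
    by (intro zmod.subspace_sum[OF subspace_sum_zero] zmod.subspace_scale[OF subspace_sum_zero] Ep_Y b_Ep) simp
  have comb_diff: "comb c - comb c' = comb (\<lambda>i. c i - c' i)" for c c'
    by (simp only: comb_def sum_subtractf[symmetric] zmod.scale_left_diff_distrib[symmetric])
  have comb_add: "comb c + comb c' = comb (\<lambda>i. c i + c' i)" for c c'
    by (simp only: comb_def sum.distrib[symmetric] zmod.scale_left_distrib[symmetric])
  \<comment> \<open>The generators carry a factor \<open>q\<close>, so \<open>r\<close> times a
    generator is \<open>q * r\<close> times an element of \<open>Y\<close>, which lies in the image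
    of \<open>L\<close>.\<close>
  have comb_mod: "cls (comb c) = cls (comb c')" if cc: "\<And>i. i < D \<Longrightarrow> c i mod r = c' i mod r" for c c'
  proof -
    have "(c i - c' i) *\<^sub>z (q *\<^sub>z (b i + M (b i))) \<in> range L" if i: "i < D" for i
    proof -
      obtain k where "c i - c' i = r * k" using cc[OF i] by (metis mod_eq_dvd_iff dvdE)
      then have "(c i - c' i) *\<^sub>z (q *\<^sub>z (b i + M (b i))) = k *\<^sub>z ((q * r) *\<^sub>z (b i + M (b i)))"
        by (simp only: zmod.scale_scale mult_ac)
      also have "\<dots> \<in> range L"
        by (rule scale_range_L, rule exponent_range_L, rule Ep_Y, rule b_Ep) (rule i)
      finally show ?thesis .
    qed
    then have "comb c - comb c' \<in> range L"
      unfolding comb_diff unfolding comb_def by (intro zmod.subspace_sum[OF subspace_range_L]) simp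
    then show ?thesis by (simp only: cls_eq_iff)
  qed
  have comb_Q: "cls (comb c) \<in> Q" for c
  proof -
    have "r ^ D = r ^ (D - 1) * r" using D by (simp add: power_eq_if)
    then have "(r ^ D) *\<^sub>z comb c = (r ^ (D - 1)) *\<^sub>z (\<Sum>i<D. c i *\<^sub>z ((q * r) *\<^sub>z (b i + M (b i))))"
      by (simp only: comb_def zmod.scale_sum_right zmod.scale_scale mult_ac)
    also have "\<dots> \<in> range L"
      by (rule scale_range_L, rule zmod.subspace_sum[OF subspace_range_L], rule scale_range_L,
          rule exponent_range_L, rule Ep_Y, rule b_Ep) simp
    finally show ?thesis using Q_iff comb_Y by blast
  qed
  have comb_surj: "\<exists>c. x = cls (comb c)" if "x \<in> Q" for x
  proof -
    have "x \<in> carrier K" using that compl(3) by blast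
    then obtain y where y: "y \<in> sum_zero" "x = cls y" by (auto simp: K_carrier)
    obtain v w where vw: "v \<in> Ep" "w \<in> Em" "s *\<^sub>z y = v + w" using eig_decomposition[OF y(1)] .
    then obtain v' where v': "v' \<in> Ep" "w = M v'" using M_eig by blast
    \<comment> \<open>Chinese remaindering: \<open>m + 1\<close> is 1 modulo \<open>m\<close>, and
      \<open>- m\<close> is 1 modulo \<open>m + 1\<close>. Therefore
      \<open>z = s v - L (v' - v)\<close> and \<open>M z = s M v' - L (M (v' - v))\<close>, so a
      single \<open>z\<close> in \<open>Ep\<close> represents both components at once.\<close>
    define z where "z = s *\<^sub>z ((m + 1) *\<^sub>z v - m *\<^sub>z v')"
    have "z \<in> zmod.span B"
      unfolding z_def B(2) using vw(1) v'(1)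
      by (intro zmod.subspace_scale[OF subspace_eig] zmod.subspace_diff[OF subspace_eig])
    then obtain k where "z = (\<Sum>v\<in>B. k v *\<^sub>z v)" using zmod.span_finite[OF B(1)] by auto
    then have k: "z = (\<Sum>i<D. k (b i) *\<^sub>z b i)"
      using sum.reindex_bij_betw[OF b, of "\<lambda>v. k v *\<^sub>z v"] by simp
    have zM: "comb (\<lambda>i. k (b i)) = q *\<^sub>z (z + M z)"
    proof -
      have "z + M z = (\<Sum>i<D. k (b i) *\<^sub>z (b i + M (b i)))"
        by (simp only: k M.sum M.scale sum.distrib[symmetric] zmod.scale_right_distrib[symmetric])
      then show ?thesis by (simp only: comb_def zmod.scale_sum_right zmod.scale_left_commute[of q])
    qed
    have Mz: "M z = s *\<^sub>z ((m + 1) *\<^sub>z M v - m *\<^sub>z M v')"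
      by (simp only: z_def M.scale M.diff)
    have u: "v' - v \<in> Ep" using vw v' zmod.subspace_diff[OF subspace_eig] by blast
    have Lu: "L (v' - v) = (s * m) *\<^sub>z (v' - v)" "L (M (v' - v)) = (s * (m + 1)) *\<^sub>z M (v' - v)"
      using u M_eig by (auto simp: eig_def)
    \<comment> \<open>Multiplying by \<open>q * q\<close> fixes \<open>x\<close>, because q^2 - 1 =
      4 r (q + 1) and \<open>r\<close> kills \<open>x\<close>. One \<open>q\<close> becomes the
      factor in \<open>comb\<close>; the other is \<open>s * s\<close>, one \<open>s\<close>
      splitting \<open>y\<close> into eigenvectors and one entering \<open>z\<close>.\<close>
    have "x = cls ((q * q) *\<^sub>z y)"
    proof -
      have "(4 * (q + 1)) *\<^sub>z (r *\<^sub>z y) \<in> range L"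
        using scale_range_L[OF r_Q[OF y(1)]] y(2) that by simp
      moreover have "(q * q) *\<^sub>z y - y = (4 * (q + 1)) *\<^sub>z (r *\<^sub>z y)"
        by (simp add: fun_eq_iff zscale_apply q_eq' algebra_simps)
      ultimately show ?thesis using y(2) cls_eq_iff by metis
    qed
    also have "(q * q) *\<^sub>z y = (q * s) *\<^sub>z (s *\<^sub>z y)"
      by (simp add: q_eq power2_eq_square mult_ac)
    also have "\<dots> = (q * s) *\<^sub>z (v + M v')" by (simp only: vw(3) v'(2))
    also have "\<dots> = q *\<^sub>z (z + M z) + q *\<^sub>z (L (v' - v) + L (M (v' - v)))"
      unfolding Lu unfolding Mz M.diff by (simp add: z_def fun_eq_iff zscale_apply algebra_simps)
    also have "\<dots> = q *\<^sub>z (z + M z) + L (q *\<^sub>z ((v' - v) + M (v' - v)))"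
      by (simp only: L.scale L.add)
    also have "cls \<dots> = cls (q *\<^sub>z (z + M z))" by (rule cls_eqI) (rule refl)
    finally show ?thesis unfolding zM[symmetric] by blast
  qed
  let ?P = "product_group {..<D} (\<lambda>_. integer_mod_group R)"
  have car_P: "carrier ?P = PiE {..<D} (\<lambda>_. {0..<r})"
    using R by (simp add: carrier_integer_mod_group)
  have "(\<lambda>c. cls (comb c)) \<in> hom ?P (K\<lparr>carrier := Q\<rparr>)"
  proof (rule homI)
    fix c c' assume "c \<in> carrier ?P" "c' \<in> carrier ?P"
    have "cls (comb (c \<otimes>\<^bsub>?P\<^esub> c')) = cls (comb (\<lambda>i. c i + c' i))"
      by (rule comb_mod) (simp add: R)
    then show "cls (comb (c \<otimes>\<^bsub>?P\<^esub> c')) = cls (comb c) \<otimes>\<^bsub>K\<lparr>carrier := Q\<rparr>\<^esub> cls (comb c')"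
      by (simp add: K_mult comb_add)
  qed (use comb_Q in simp)
  moreover have "bij_betw (\<lambda>c. cls (comb c)) (carrier ?P) Q"
  proof -
    have im: "(\<lambda>c. cls (comb c)) ` carrier ?P = Q"
    proof (intro equalityI subsetI)
      fix x assume "x \<in> Q"
      then obtain c where c: "x = cls (comb c)" using comb_surj by blast
      have "x = cls (comb (\<lambda>i\<in>{..<D}. c i mod r))" unfolding c by (rule comb_mod) simp
      moreover have "(\<lambda>i\<in>{..<D}. c i mod r) \<in> carrier ?P"
        unfolding car_P using r_pos by auto
      ultimately show "x \<in> (\<lambda>c. cls (comb c)) ` carrier ?P" by blast
    qed (use comb_Q in blast)
    \<comment> \<open>A surjection between finite sets of the same size \<open>R ^ D\<close> is
      injective.\<close>
    have "card (carrier ?P) = R ^ D" unfolding car_P by (simp add: card_PiE R_def)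
    moreover have "finite (carrier ?P)" unfolding car_P by (simp add: finite_PiE)
    ultimately have "inj_on (\<lambda>c. cls (comb c)) (carrier ?P)"
      using compl(2) im by (intro eq_card_imp_inj_on) simp_all
    then show ?thesis using im by (simp add: bij_betw_def)
  qed
  ultimately have "?P \<cong> K\<lparr>carrier := Q\<rparr>" by (auto simp: is_iso_def iso_def)
  then show "K\<lparr>carrier := Q\<rparr> \<cong> product_group {..<nat (2 * r)} (\<lambda>_. integer_mod_group (nat r))"
    unfolding D_def R_def by (rule group.iso_sym[rotated]) simp
qed

lemma sylow_decomposition_critical_group: "\<exists>P Q. sylow_decomposition p K P Q"
proof -
  have "int (card (carrier K)) > 0" unfolding card_K using q_pos r_pos by simp
  then have "card (carrier K) > 0" by simp
  then show ?thesis
    using comm_group.sylow_decomposition_exists[OF K_comm_group _ p] card_gt_0_iff by blast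
qed

end

section \<open>The Peisert graph\<close>

locale quartic_field =
  fixes p t q :: nat and \<beta> :: "'a :: {field, finite}"
  assumes p: "Factorial_Ring.prime p" "p mod 4 = 3" and t: "t \<ge> 1" and q: "q = p ^ (2 * t)"
    and card: "card (UNIV :: 'a set) = q" and prim: "primitive_element \<beta>"
begin

section \<open>Arithmetic of \<open>q\<close> and powers of the primitive element\<close>

text \<open>Odd squares are 1 modulo 8. This gives a quartic character, makes -1 a fourth power, and
  lets \<open>(q - 3) div 2\<close> be an exact division.\<close>

lemma q_mod_8: "q mod 8 = 1"
proof -
  have "p mod 8 = 3 \<or> p mod 8 = 7" using p(2) by presburger
  then have "p\<^sup>2 mod 8 = 1" by (auto simp: power_mod[of p 8, symmetric])
  then have "(p\<^sup>2) ^ t mod 8 = 1" by (subst power_mod[symmetric]) simp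
  then show ?thesis by (simp add: q power_mult)
qed

lemma q_ge: "q \<ge> 9"
proof -
  have "q > 1" unfolding q by (rule one_less_power) (use prime_gt_1_nat[OF p(1)] t in simp_all)
  then show ?thesis using q_mod_8 by presburger
qed

lemma beta_nz: "\<beta> \<noteq> 0"
  using prim by (simp add: primitive_element_def)

lemma pow_q: "x ^ (q - 1) = 1" if "x \<noteq> (0::'a)"
proof -
  have inj: "inj_on ((*) x) (UNIV - {0})" using that by (auto simp: inj_on_def)
  have im: "(*) x ` (UNIV - {0}) = UNIV - {0}"
    by (rule endo_inj_surj[OF _ _ inj]) (use that in auto)
  have "(\<Prod>y\<in>UNIV - {0}. y) = (\<Prod>y\<in>(*) x ` (UNIV - {0}). y)" by (simp only: im)
  also have "\<dots> = (\<Prod>y\<in>UNIV - {0}. x * y)" by (simp add: prod.reindex[OF inj])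
  also have "\<dots> = x ^ (q - 1) * (\<Prod>y\<in>UNIV - {0}. y)"
    by (simp add: prod.distrib card card_Diff_subset)
  finally show ?thesis by simp
qed

text \<open>The first \<open>q - 1\<close> powers already exhaust the \<open>q - 1\<close> nonzero
  elements, so they are pairwise distinct.\<close>

lemma beta_pow_eq_iff: "\<beta> ^ i = \<beta> ^ j \<longleftrightarrow> i mod (q - 1) = j mod (q - 1)"
proof -
  have q1: "q - 1 > 0" using q_ge by simp
  have red: "\<beta> ^ i = \<beta> ^ (i mod (q - 1))" for i
  proof -
    have "\<beta> ^ i = (\<beta> ^ (q - 1)) ^ (i div (q - 1)) * \<beta> ^ (i mod (q - 1))"
      by (simp flip: power_mult power_add)
    then show ?thesis using pow_q[OF beta_nz] by simp
  qed
  have "(\<lambda>i. \<beta> ^ i) ` {..<q - 1} = UNIV - {0}"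
  proof (intro equalityI subsetI)
    fix x assume "x \<in> (\<lambda>i. \<beta> ^ i) ` {..<q - 1}"
    then show "x \<in> UNIV - {0}" using beta_nz by auto
  next
    fix x :: 'a assume "x \<in> UNIV - {0}"
    then obtain n where "x = \<beta> ^ n" using prim by (auto simp: primitive_element_def)
    then have "x = \<beta> ^ (n mod (q - 1))" using red by simp
    then show "x \<in> (\<lambda>i. \<beta> ^ i) ` {..<q - 1}" using q1 by auto
  qed
  then have "inj_on (\<lambda>i. \<beta> ^ i) {..<q - 1}"
    by (intro eq_card_imp_inj_on) (auto simp: card card_Diff_subset)
  then have "\<beta> ^ (i mod (q - 1)) = \<beta> ^ (j mod (q - 1)) \<longleftrightarrow> i mod (q - 1) = j mod (q - 1)"
    using q1 by (auto dest: inj_onD)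
  then show ?thesis using red[of i] red[of j] by simp
qed

section \<open>The quartic character and the connection set\<close>

text \<open>The multiplicative character of order 4 sending \<open>\<beta>\<close> to the imaginary
  unit, extended by 0. The discrete logarithm is an arbitrary choice; its residue modulo 4 is well
  defined because 4 divides \<open>q - 1\<close>.\<close>

definition chi :: "'a \<Rightarrow> complex" where
  "chi x = (if x = 0 then 0 else \<i> ^ (SOME n. x = \<beta> ^ n))"

lemma chi_0 [simp]: "chi 0 = 0"
  by (simp add: chi_def)

lemma i_pow_mod: "\<i> ^ n = \<i> ^ (n mod 4)"
proof -
  have "\<i> ^ n = \<i> ^ (4 * (n div 4) + n mod 4)" by (simp only: mult_div_mod_eq)
  then have "\<i> ^ n = (\<i> ^ 4) ^ (n div 4) * \<i> ^ (n mod 4)" by (simp only: power_add power_mult)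
  moreover have "\<i> ^ 4 = (1 :: complex)" by (simp add: power4_eq_xxxx)
  ultimately show ?thesis by (simp only: power_one mult_1)
qed

lemma chi_beta_pow: "chi (\<beta> ^ n) = \<i> ^ n"
proof -
  have "\<beta> ^ n = \<beta> ^ (SOME k. \<beta> ^ n = \<beta> ^ k)" by (rule someI) simp
  then have "n mod (q - 1) = (SOME k. \<beta> ^ n = \<beta> ^ k) mod (q - 1)" by (simp add: beta_pow_eq_iff)
  moreover have "4 dvd q - 1" using q_mod_8 by presburger
  ultimately have "n mod 4 = (SOME k. \<beta> ^ n = \<beta> ^ k) mod 4" by (metis mod_mod_cancel)
  then have "\<i> ^ n = \<i> ^ (SOME k. \<beta> ^ n = \<beta> ^ k)"
    using i_pow_mod[of n] i_pow_mod[of "SOME k. \<beta> ^ n = \<beta> ^ k"] by simp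
  then show ?thesis using beta_nz by (simp add: chi_def)
qed

lemma beta_cases:
  obtains "x = 0" | n where "x = \<beta> ^ n"
  using prim unfolding primitive_element_def by blast

lemma chi_mult: "chi (x * y) = chi x * chi y"
proof (cases x rule: beta_cases)
  case (2 n)
  show ?thesis
  proof (cases y rule: beta_cases)
    case (2 k)
    have "chi (x * y) = chi (\<beta> ^ (n + k))" by (simp only: \<open>x = \<beta> ^ n\<close> 2 power_add)
    also have "\<dots> = \<i> ^ n * \<i> ^ k" by (subst chi_beta_pow) (rule power_add)
    finally show ?thesis by (simp only: \<open>x = \<beta> ^ n\<close> 2 chi_beta_pow)
  qed simp
qed auto

lemma chi_power: "n > 0 \<Longrightarrow> chi (x ^ n) = chi x ^ n"
proof (induction n rule: nat_induct_non_zero)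
  case 1
  show ?case by simp
next
  case (Suc n)
  then show ?case by (simp only: power_Suc chi_mult)
qed

lemma chi_beta: "chi \<beta> = \<i>"
  using chi_beta_pow[of 1] by simp

text \<open>-1 is \<open>\<beta>\<close> to the power \<open>(q - 1) div 2\<close>, an exponent
  divisible by 4.\<close>

lemma chi_minus: "chi (- x) = chi x"
proof -
  have "(\<beta> ^ ((q - 1) div 2))\<^sup>2 = 1"
  proof -
    have "(q - 1) div 2 * 2 = q - 1" using q_mod_8 by presburger
    then show ?thesis using pow_q[OF beta_nz] by (simp flip: power_mult)
  qed
  moreover have "\<beta> ^ ((q - 1) div 2) \<noteq> \<beta> ^ 0"
    unfolding beta_pow_eq_iff using q_ge by simp
  ultimately have m1: "\<beta> ^ ((q - 1) div 2) = - 1" by (simp add: power2_eq_1_iff)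
  have "(q - 1) div 2 mod 4 = 0" using q_mod_8 by presburger
  then have "chi (- 1) = 1" unfolding m1[symmetric] chi_beta_pow using i_pow_mod by (metis power_0)
  then show ?thesis using chi_mult[of "- 1" x] by simp
qed

lemma chi_values: "x \<noteq> 0 \<Longrightarrow> chi x = 1 \<or> chi x = \<i> \<or> chi x = - 1 \<or> chi x = - \<i>"
proof -
  assume "x \<noteq> 0"
  then obtain n where n: "x = \<beta> ^ n" by (cases x rule: beta_cases) auto
  have "n mod 4 = 0 \<or> n mod 4 = 1 \<or> n mod 4 = 2 \<or> n mod 4 = 3" by presburger
  then have "\<i> ^ (n mod 4) = 1 \<or> \<i> ^ (n mod 4) = \<i> \<or> \<i> ^ (n mod 4) = - 1 \<or> \<i> ^ (n mod 4) = - \<i>"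
    by (elim disjE) (simp_all add: power3_eq_cube)
  then show ?thesis unfolding n chi_beta_pow by (simp add: i_pow_mod[of n])
qed

lemma peisert_set_iff: "x \<in> peisert_set \<beta> \<longleftrightarrow> chi x = 1 \<or> chi x = \<i>"
proof -
  have fp: "x \<in> fourth_powers \<longleftrightarrow> chi x = 1" for x :: 'a
  proof
    assume "x \<in> fourth_powers"
    then obtain y where y: "x = y ^ 4" "y \<noteq> 0" by (auto simp: fourth_powers_def)
    then have "chi x = chi y ^ 4" by (simp only: y chi_power)
    then show "chi x = 1" using chi_values[OF y(2)] by (elim disjE) (simp_all add: power4_eq_xxxx)
  next
    assume 1: "chi x = 1"
    then have "x \<noteq> 0" by auto
    then obtain n where n: "x = \<beta> ^ n" by (cases x rule: beta_cases) auto
    have i: "\<i> ^ (n mod 4) = 1" using 1 n chi_beta_pow i_pow_mod[of n] by simp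
    have "n mod 4 = 0 \<or> n mod 4 = 1 \<or> n mod 4 = 2 \<or> n mod 4 = 3" by presburger
    then have "n mod 4 = 0" using i by (elim disjE) (simp_all add: power3_eq_cube complex_eq_iff)
    then have "n = n div 4 * 4" by presburger
    then have "x = (\<beta> ^ (n div 4)) ^ 4" using n by (metis power_mult)
    then show "x \<in> fourth_powers" using beta_nz by (auto simp: fourth_powers_def)
  qed
  have "x \<in> (*) \<beta> ` fourth_powers \<longleftrightarrow> chi x = \<i>"
  proof
    assume "x \<in> (*) \<beta> ` fourth_powers"
    then show "chi x = \<i>" by (auto simp: fp chi_mult chi_beta)
  next
    assume "chi x = \<i>"
    moreover have "chi x = \<i> * chi (x / \<beta>)" using chi_mult[of \<beta> "x / \<beta>"] beta_nz chi_beta by simp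
    ultimately have "x / \<beta> \<in> fourth_powers" by (simp add: fp)
    then show "x \<in> (*) \<beta> ` fourth_powers" using beta_nz by (intro image_eqI[of _ _ "x / \<beta>"]) auto
  qed
  then show ?thesis by (simp add: peisert_set_def fp)
qed

text \<open>Equals +1 on the connection set, -1 on the other nonzero elements and 0 at 0. It is the
  real part of (1 - i) times \<open>chi\<close>, which reduces its convolution to character
  sums.\<close>

definition phi :: "'a \<Rightarrow> real" where
  "phi x = Re (chi x) + Im (chi x)"

lemma phi_peisert: "phi x = 2 * of_bool (x \<in> peisert_set \<beta>) - of_bool (x \<noteq> 0)"
proof (cases "x = 0")
  case False
  then show ?thesis using chi_values[OF False] by (auto simp: phi_def peisert_set_iff complex_eq_iff)
qed (simp add: phi_def peisert_set_iff complex_eq_iff)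

lemma phi_minus: "phi (- x) = phi x"
  by (simp add: phi_def chi_minus)

lemma phi_beta_sq: "phi (\<beta>\<^sup>2 * x) = - phi x"
proof -
  have "chi (\<beta>\<^sup>2 * x) = \<i> * \<i> * chi x" by (simp only: power2_eq_square chi_mult chi_beta)
  then show ?thesis by (simp add: phi_def)
qed

text \<open>Substituting \<open>\<beta> * x\<close> for \<open>x\<close> multiplies the sum by the
  imaginary unit.\<close>

lemma sum_chi: "sum chi UNIV = 0"
proof -
  have "sum chi UNIV = (\<Sum>x\<in>UNIV. chi (\<beta> * x))"
    by (rule sum.reindex_bij_witness[of _ "\<lambda>x. \<beta> * x" "\<lambda>x. x / \<beta>"]) (use beta_nz in auto)
  also have "\<dots> = \<i> * sum chi UNIV" by (simp add: chi_mult chi_beta sum_distrib_left)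
  finally have "(1 - \<i>) * sum chi UNIV = 0" by (simp add: algebra_simps)
  then show ?thesis by (simp add: complex_eq_iff)
qed

lemma sum_phi: "sum phi UNIV = 0"
proof -
  have "sum phi UNIV = Re (sum chi UNIV) + Im (sum chi UNIV)"
    by (simp add: phi_def sum.distrib)
  then show ?thesis by (simp add: sum_chi)
qed

section \<open>Frobenius and the character sums\<close>

text \<open>Translating by 1 permutes the field, so the sum of all elements is unchanged and
  \<open>q\<close> times 1 vanishes.\<close>

lemma char_p: "CHAR('a) = p"
proof -
  have "(\<Sum>x\<in>UNIV. x :: 'a) = (\<Sum>x\<in>UNIV. x + 1)"
    by (rule sum.reindex_bij_witness[of _ "\<lambda>x. x + 1" "\<lambda>x. x - 1"]) auto
  then have "of_nat q = (0 :: 'a)" by (simp add: sum.distrib card)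
  then have "of_nat p = (0 :: 'a)" unfolding q by simp
  then have "CHAR('a) dvd p" by (simp add: of_nat_eq_0_iff_char_dvd)
  then have "CHAR('a) = 1 \<or> CHAR('a) = p" using p(1) unfolding prime_nat_iff by blast
  then show ?thesis by simp
qed

lemma frobenius_diff: "(x - y) ^ p = x ^ p - (y :: 'a) ^ p"
proof -
  have "((x - y) + y) ^ p = (x - y) ^ p + y ^ p"
    by (rule freshmans_dream) (simp_all only: char_p p(1))
  then show ?thesis by simp
qed

lemma bij_frobenius: "bij (\<lambda>x :: 'a. x ^ p)"
proof -
  have "inj (\<lambda>x :: 'a. x ^ p)"
  proof (rule injI)
    fix x y :: 'a assume "x ^ p = y ^ p"
    then have "(x - y) ^ p = 0" by (simp add: frobenius_diff)
    then show "x = y" by simp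
  qed
  then show ?thesis by (simp add: bij_def finite_UNIV_inj_surj)
qed

text \<open>For a fourth root of unity the \<open>p\<close>-th power is the cube, that is, the
  inverse, as \<open>p\<close> is 3 modulo 4.\<close>

lemma chi_frobenius: "chi (x ^ p) = cnj (chi x)"
proof (cases "x = 0")
  case True
  then show ?thesis using prime_gt_0_nat[OF p(1)] by (simp add: zero_power)
next
  case False
  have ip: "\<i> ^ p = - \<i>" using i_pow_mod[of p] p(2) by (simp add: power3_eq_cube)
  have "odd p" using p(2) by presburger
  then have "(- z) ^ p = - (z ^ p)" for z :: complex by (rule power_minus_odd)
  moreover have "chi (x ^ p) = chi x ^ p" using p(1) by (simp add: chi_power prime_gt_0_nat)
  ultimately show ?thesis using chi_values[OF False] ip by (elim disjE) simp_all
qed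

lemma chi_1: "chi 1 = 1"
  using chi_beta_pow[of 0] by simp

lemma chi_inverse: "chi (inverse x) = cnj (chi x)"
proof (cases "x = 0")
  case False
  then have "chi x * chi (inverse x) = 1" by (simp flip: chi_mult add: chi_1)
  then show ?thesis using chi_values[OF False] by (auto simp: complex_eq_iff)
qed simp

text \<open>The Jacobi sum \<open>J(\<chi>, \<chi>)\<close> is real: since \<open>p \<equiv> 3 (mod 4)\<close>, the Frobenius automorphism conjugates \<open>\<chi>\<close>.\<close>

lemma Im_chi_conv: "Im (\<Sum>x\<in>UNIV. chi x * chi (d - x)) = 0"
proof (cases "d = 0")
  case True
  have "Im (chi x * chi x) = 0" for x
    using chi_values[of x] by (cases "x = 0") auto
  then show ?thesis by (simp only: True diff_0 chi_minus Im_sum sum.neutral_const)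
next
  case False
  define J where "J = (\<Sum>x\<in>UNIV. chi x * chi (1 - x))"
  have "J = (\<Sum>x\<in>UNIV. chi (x ^ p) * chi (1 - x ^ p))"
    unfolding J_def by (rule sum.reindex_bij_betw[symmetric]) (rule bij_frobenius)
  also have "\<dots> = (\<Sum>x\<in>UNIV. cnj (chi x * chi (1 - x)))"
  proof (rule sum.cong)
    fix x :: 'a
    have "chi (1 - x ^ p) = chi ((1 - x) ^ p)" by (simp add: frobenius_diff)
    then show "chi (x ^ p) * chi (1 - x ^ p) = cnj (chi x * chi (1 - x))"
      by (simp add: chi_frobenius)
  qed simp
  finally have "J = cnj J" by (simp add: J_def)
  then have J: "Im J = 0" by (metis cnj.simps(2) neg_equal_zero)
  have "(\<Sum>x\<in>UNIV. chi x * chi (d - x)) = (\<Sum>x\<in>UNIV. chi (d * x) * chi (d - d * x))"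
    by (rule sum.reindex_bij_witness[of _ "\<lambda>x. d * x" "\<lambda>x. x / d"]) (use False in auto)
  also have "\<dots> = (\<Sum>x\<in>UNIV. chi d * chi d * (chi x * chi (1 - x)))"
  proof (rule sum.cong)
    fix x :: 'a
    have "d - d * x = d * (1 - x)" by (simp add: right_diff_distrib)
    then show "chi (d * x) * chi (d - d * x) = chi d * chi d * (chi x * chi (1 - x))"
      by (simp only: chi_mult mult_ac)
  qed simp
  also have "\<dots> = chi d * chi d * J" by (simp add: J_def sum_distrib_left)
  finally show ?thesis using chi_values[OF False] J by auto
qed

text \<open>For nonzero \<open>d\<close> the summand is \<open>chi (x / (d - x))\<close>. This
  fractional linear map carries the field without \<open>d\<close> bijectively onto the field
  without -1, so only \<open>- chi (- 1)\<close> remains of the full character sum.\<close>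

lemma chi_cnj_conv: "(\<Sum>x\<in>UNIV. chi x * cnj (chi (d - x))) = of_nat q * of_bool (d = 0) - 1"
proof (cases "d = 0")
  case True
  have "chi x * cnj (chi x) = of_bool (x \<noteq> 0)" for x :: 'a
    using chi_values[of x] by (cases "x = 0") auto
  then have "(\<Sum>x\<in>UNIV. chi x * cnj (chi (d - x))) = (\<Sum>x\<in>UNIV. of_bool (x \<noteq> (0 :: 'a)))"
    by (simp only: True diff_0 chi_minus)
  also have "\<dots> = of_nat (card (UNIV - {0 :: 'a}))"
    by (simp add: Collect_neg_eq Compl_eq_Diff_UNIV)
  also have "\<dots> = of_nat q - 1" using q_ge by (simp add: card card_Diff_subset)
  finally show ?thesis using True by simp
next
  case False
  have "(\<Sum>x\<in>UNIV. chi x * cnj (chi (d - x))) = (\<Sum>x\<in>UNIV. chi (x / (d - x)))"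
    by (simp only: divide_inverse chi_mult chi_inverse)
  also have "\<dots> = (\<Sum>x\<in>UNIV - {d}. chi (x / (d - x)))"
    by (rule sum.mono_neutral_right) auto
  also have "\<dots> = (\<Sum>y\<in>UNIV - {- 1}. chi y)"
  proof (rule sum.reindex_bij_witness[of _ "\<lambda>y. d * y / (1 + y)" "\<lambda>x. x / (d - x)"])
    fix x assume "x \<in> UNIV - {d}"
    then have dx: "d - x \<noteq> 0" by simp
    then have 1: "1 + x / (d - x) = d / (d - x)" by (simp add: add_divide_eq_iff)
    then show "d * (x / (d - x)) / (1 + x / (d - x)) = x" using dx False by simp
    have "1 + x / (d - x) \<noteq> 0" using 1 dx False by simp
    then show "x / (d - x) \<in> UNIV - {- 1}" by auto
  next
    fix y :: 'a assume "y \<in> UNIV - {- 1}"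
    then have y: "1 + y \<noteq> 0" by (simp add: add_eq_0_iff)
    then have 1: "d - d * y / (1 + y) = d / (1 + y)" by (simp add: diff_divide_eq_iff algebra_simps)
    then show "d * y / (1 + y) / (d - d * y / (1 + y)) = y" using y False by simp
    have "d - d * y / (1 + y) \<noteq> 0" using 1 y False by simp
    then show "d * y / (1 + y) \<in> UNIV - {d}" by auto
  qed simp
  also have "\<dots> = sum chi UNIV - chi (- 1)" by (simp add: sum_diff1)
  finally show ?thesis using False chi_minus[of 1] by (simp add: sum_chi chi_1)
qed

lemma phi_conv: "(\<Sum>x\<in>UNIV. phi x * phi (d - x)) = of_nat q * of_bool (d = 0) - 1"
proof -
  \<comment> \<open>Expanding (Re + Im) (Re + Im) isolates the Jacobi-type sum in an imaginary part,
    where \<open>Im_chi_conv\<close> makes it vanish.\<close>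
  have "phi x * phi y = Re (chi x * cnj (chi y)) + Im (chi x * chi y)" for x y
    by (simp add: phi_def algebra_simps)
  then have "(\<Sum>x\<in>UNIV. phi x * phi (d - x))
      = Re (\<Sum>x\<in>UNIV. chi x * cnj (chi (d - x))) + Im (\<Sum>x\<in>UNIV. chi x * chi (d - x))"
    by (simp only: sum.distrib Re_sum Im_sum)
  then show ?thesis unfolding chi_cnj_conv Im_chi_conv by simp
qed

section \<open>Integral form and the Laplacian matrix\<close>

definition phiZ :: "'a \<Rightarrow> int" where
  "phiZ x = 2 * of_bool (x \<in> peisert_set \<beta>) - of_bool (x \<noteq> 0)"

lemma of_int_phiZ: "of_int (phiZ x) = phi x"
  by (simp add: phiZ_def phi_peisert)

lemma sum_phiZ: "sum phiZ UNIV = 0"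
proof -
  have "of_int (sum phiZ UNIV) = (0 :: real)" by (simp add: of_int_phiZ sum_phi)
  then show ?thesis by (simp only: of_int_eq_0_iff)
qed

lemma phiZ_conv: "(\<Sum>x\<in>UNIV. phiZ x * phiZ (d - x)) = int q * of_bool (d = 0) - 1"
proof -
  have "real_of_int (\<Sum>x\<in>UNIV. phiZ x * phiZ (d - x)) = of_int (int q * of_bool (d = 0) - 1)"
    by (simp add: of_int_phiZ phi_conv)
  then show ?thesis by (simp only: of_int_eq_iff)
qed

lemma phiZ_minus: "phiZ (- x) = phiZ x"
proof -
  have "real_of_int (phiZ (- x)) = of_int (phiZ x)" by (simp only: of_int_phiZ phi_minus)
  then show ?thesis by (simp only: of_int_eq_iff)
qed

lemma phiZ_beta_sq: "phiZ (\<beta>\<^sup>2 * x) = - phiZ x"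
proof -
  have "real_of_int (phiZ (\<beta>\<^sup>2 * x)) = of_int (- phiZ x)" by (simp only: of_int_phiZ phi_beta_sq of_int_minus)
  then show ?thesis by (simp only: of_int_eq_iff)
qed

lemma zero_notin_peisert_set: "0 \<notin> peisert_set \<beta>"
  by (simp add: peisert_set_iff)

lemma two_card_peisert_set: "2 * int (card (peisert_set \<beta>)) = int q - 1"
proof -
  have "(0 :: int) = (\<Sum>x\<in>UNIV. 2 * of_bool (x \<in> peisert_set \<beta>) - of_bool (x \<noteq> (0 :: 'a)))"
    unfolding phiZ_def[symmetric] by (rule sum_phiZ[symmetric])
  also have "\<dots> = 2 * (\<Sum>x\<in>UNIV. of_bool (x \<in> peisert_set \<beta>)) - (\<Sum>x\<in>UNIV. of_bool (x \<noteq> (0 :: 'a)))"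
    by (simp only: sum_subtractf sum_distrib_left)
  also have "\<dots> = 2 * int (card (peisert_set \<beta>)) - int (card (UNIV - {0 :: 'a}))"
    by (simp add: Collect_neg_eq Compl_eq_Diff_UNIV)
  also have "card (UNIV - {0 :: 'a}) = q - 1" by (simp add: card card_Diff_subset)
  finally show ?thesis using q_ge by (simp add: of_nat_diff)
qed

lemma out_degree_peisert: "out_degree (with_proj (peisert_graph \<beta>)) x = card (peisert_set \<beta>)"
proof -
  have "out_arcs (with_proj (peisert_graph \<beta>)) x = (\<lambda>d. (x, x - d)) ` peisert_set \<beta>"
  proof (intro equalityI subsetI)
    fix e assume "e \<in> out_arcs (with_proj (peisert_graph \<beta>)) x"
    then have "e = (x, x - (x - snd e))" "x - snd e \<in> peisert_set \<beta>"
      by (auto simp: out_arcs_def peisert_graph_def)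
    then show "e \<in> (\<lambda>d. (x, x - d)) ` peisert_set \<beta>" by blast
  next
    fix e assume "e \<in> (\<lambda>d. (x, x - d)) ` peisert_set \<beta>"
    then show "e \<in> out_arcs (with_proj (peisert_graph \<beta>)) x"
      using zero_notin_peisert_set by (auto simp: out_arcs_def peisert_graph_def)
  qed
  moreover have "inj_on (\<lambda>d. (x, x - d)) (peisert_set \<beta>)" by (auto simp: inj_on_def)
  ultimately show ?thesis by (simp add: out_degree_def card_image)
qed

text \<open>With Phi the matrix of \<open>phiZ (x - y)\<close> and J the all-ones matrix, 2 A = Phi
  + J - I and twice the degree is q - 1. Doubling keeps the identity integral.\<close>

lemma two_laplacian: "2 * laplacian (peisert_graph \<beta>) x y = int q * of_bool (x = y) - phiZ (x - y) - 1"
proof -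
  have "(x, y) \<in> parcs (peisert_graph \<beta>) \<longleftrightarrow> x \<noteq> y \<and> x - y \<in> peisert_set \<beta>"
    by (simp add: peisert_graph_def)
  then show ?thesis
    using two_card_peisert_set zero_notin_peisert_set
    by (simp add: laplacian_def out_degree_peisert phiZ_def)
qed

abbreviation "L \<equiv> laplacian_map (peisert_graph \<beta>)"

section \<open>Operator identities on integer vectors\<close>

definition conv :: "('a \<Rightarrow> int) \<Rightarrow> 'a \<Rightarrow> int" where
  "conv g = (\<lambda>x. \<Sum>y\<in>UNIV. phiZ (x - y) * g y)"

definition mul :: "('a \<Rightarrow> int) \<Rightarrow> 'a \<Rightarrow> int" where
  "mul g = (\<lambda>x. g (\<beta>\<^sup>2 * x))"

lemma L_apply: "L g x = (\<Sum>y\<in>UNIV. laplacian (peisert_graph \<beta>) x y * g y)"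
  by (simp add: laplacian_map_def peisert_graph_def)

lemma two_L: "2 * L g x = int q * g x - conv g x - sum g UNIV"
proof -
  have "2 * L g x = (\<Sum>y\<in>UNIV. (int q * of_bool (x = y) - phiZ (x - y) - 1) * g y)"
    by (simp only: L_apply sum_distrib_left mult.assoc[symmetric] two_laplacian)
  also have "\<dots> = (\<Sum>y\<in>UNIV. int q * (of_bool (x = y) * g y) - phiZ (x - y) * g y - g y)"
    by (intro sum.cong) (simp_all add: algebra_simps)
  also have "\<dots> = int q * (\<Sum>y\<in>UNIV. of_bool (x = y) * g y) - conv g x - sum g UNIV"
    by (simp only: sum_subtractf sum_distrib_left conv_def)
  also have "(\<Sum>y\<in>UNIV. of_bool (x = y) * g y) = (\<Sum>y\<in>UNIV. if x = y then g y else 0)"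
    by (intro sum.cong) simp_all
  also have "\<dots> = g x" by simp
  finally show ?thesis .
qed

lemma sum_phiZ_shift: "(\<Sum>x\<in>UNIV. phiZ (x - y)) = 0"
proof -
  have "(\<Sum>x\<in>UNIV. phiZ (x - y)) = sum phiZ UNIV"
    by (rule sum.reindex_bij_witness[of _ "\<lambda>x. x + y" "\<lambda>x. x - y"]) auto
  then show ?thesis by (simp add: sum_phiZ)
qed

lemma sum_conv: "sum (conv g) UNIV = 0"
proof -
  have "sum (conv g) UNIV = (\<Sum>y\<in>UNIV. (\<Sum>x\<in>UNIV. phiZ (x - y)) * g y)"
    unfolding conv_def by (subst sum.swap) (simp only: sum_distrib_right)
  then show ?thesis by (simp add: sum_phiZ_shift)
qed

text \<open>The conference identity Phi^2 = q I - J, obtained from the convolution formula after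
  exchanging the sums.\<close>

lemma conv_conv: "conv (conv g) x = int q * g x - sum g UNIV"
proof -
  have inner: "(\<Sum>z\<in>UNIV. phiZ (x - z) * phiZ (z - w)) = int q * of_bool (x = w) - 1" for w
  proof -
    have "(\<Sum>z\<in>UNIV. phiZ (x - z) * phiZ (z - w)) = (\<Sum>u\<in>UNIV. phiZ u * phiZ ((x - w) - u))"
      by (rule sum.reindex_bij_witness[of _ "\<lambda>u. x - u" "\<lambda>z. x - z"]) (auto simp: algebra_simps)
    then show ?thesis using phiZ_conv[of "x - w"] by simp
  qed
  have "conv (conv g) x = (\<Sum>w\<in>UNIV. \<Sum>z\<in>UNIV. phiZ (x - z) * phiZ (z - w) * g w)"
    unfolding conv_def by (subst sum.swap) (simp only: sum_distrib_left mult.assoc)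
  also have "\<dots> = (\<Sum>w\<in>UNIV. (int q * of_bool (x = w) - 1) * g w)"
    by (simp only: inner sum_distrib_right[symmetric])
  also have "\<dots> = (\<Sum>w\<in>UNIV. int q * (if x = w then g w else 0) - g w)"
    by (intro sum.cong) (simp_all add: algebra_simps)
  also have "\<dots> = int q * (\<Sum>w\<in>UNIV. if x = w then g w else 0) - sum g UNIV"
    by (simp only: sum_subtractf sum_distrib_left)
  finally show ?thesis by simp
qed

lemma conv_mul: "conv (mul g) x = - conv g (\<beta>\<^sup>2 * x)"
proof -
  have "conv (mul g) x = (\<Sum>y\<in>UNIV. - (phiZ (\<beta>\<^sup>2 * x - \<beta>\<^sup>2 * y) * g (\<beta>\<^sup>2 * y)))"
    unfolding conv_def mul_def
  proof (rule sum.cong)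
    fix y
    have "phiZ (\<beta>\<^sup>2 * x - \<beta>\<^sup>2 * y) = - phiZ (x - y)"
      using phiZ_beta_sq[of "x - y"] by (simp add: right_diff_distrib)
    then show "phiZ (x - y) * g (\<beta>\<^sup>2 * y) = - (phiZ (\<beta>\<^sup>2 * x - \<beta>\<^sup>2 * y) * g (\<beta>\<^sup>2 * y))" by simp
  qed simp
  also have "\<dots> = (\<Sum>z\<in>UNIV. - (phiZ (\<beta>\<^sup>2 * x - z) * g z))"
    by (rule sum.reindex_bij_witness[of _ "\<lambda>z. z / \<beta>\<^sup>2" "\<lambda>y. \<beta>\<^sup>2 * y"]) (use beta_nz in auto)
  finally show ?thesis by (simp add: conv_def sum_negf)
qed

lemma bij_beta_sq: "bij (\<lambda>x. \<beta>\<^sup>2 * x)"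
  by (rule bij_betw_byWitness[where f' = "\<lambda>x. x / \<beta>\<^sup>2"]) (use beta_nz in auto)

lemma sum_phiZ_shift': "(\<Sum>y\<in>UNIV. phiZ (x - y)) = 0"
proof -
  have "(\<Sum>y\<in>UNIV. phiZ (x - y)) = (\<Sum>y\<in>UNIV. phiZ (y - x))"
    by (rule sum.cong) (simp_all flip: phiZ_minus[of "_ - x"])
  then show ?thesis by (simp only: sum_phiZ_shift)
qed

lemma two_conv_L: "2 * conv (L g) x = int q * conv g x - conv (conv g) x"
proof -
  have "2 * conv (L g) x = (\<Sum>y\<in>UNIV. phiZ (x - y) * (2 * L g y))"
    unfolding conv_def by (simp only: sum_distrib_left mult_ac)
  also have "\<dots> = (\<Sum>y\<in>UNIV. int q * (phiZ (x - y) * g y) - phiZ (x - y) * conv g y - sum g UNIV * phiZ (x - y))"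
    unfolding two_L by (intro sum.cong) (simp_all only: right_diff_distrib mult_ac)
  also have "\<dots> = int q * conv g x - conv (conv g) x - sum g UNIV * (\<Sum>y\<in>UNIV. phiZ (x - y))"
    by (simp only: sum_subtractf sum_distrib_left conv_def)
  finally show ?thesis by (simp add: sum_phiZ_shift')
qed

lemma sum_L: "sum (L g) UNIV = 0"
proof -
  have "2 * sum (L g) UNIV = (\<Sum>x\<in>UNIV. int q * g x - conv g x - sum g UNIV)"
    by (simp only: sum_distrib_left two_L)
  also have "\<dots> = int q * sum g UNIV - sum (conv g) UNIV - int q * sum g UNIV"
    by (simp add: sum_subtractf sum_distrib_left card)
  finally show ?thesis by (simp add: sum_conv)
qed

lemma L_const: "L (\<lambda>_. c) = 0"
proof
  fix x
  have "conv (\<lambda>_. c) x = (\<Sum>y\<in>UNIV. phiZ (x - y)) * c"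
    by (simp only: conv_def sum_distrib_right)
  then have "2 * L (\<lambda>_. c) x = 0" unfolding two_L by (simp add: sum_phiZ_shift' card)
  then show "L (\<lambda>_. c) x = 0 x" by simp
qed

lemma sum_mul: "sum (mul g) UNIV = sum g UNIV"
  unfolding mul_def by (rule sum.reindex_bij_betw[OF bij_beta_sq])

lemma bij_mul: "bij mul"
  by (rule o_bij[of "\<lambda>g x. g (x / \<beta>\<^sup>2)"]) (use beta_nz in \<open>simp_all add: mul_def fun_eq_iff\<close>)

lemma L_hom: "module_hom zscale zscale L"
proof -
  have "L (f + g) = L f + L g" for f g
    by (rule ext) (simp add: L_apply distrib_left sum.distrib)
  moreover have "L (c *\<^sub>z g) = c *\<^sub>z L g" for c g
    by (rule ext) (simp add: L_apply zscale_apply sum_distrib_left mult_ac)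
  ultimately show ?thesis using zmod.module_axioms by (simp only: module_hom_iff) blast
qed

lemma mul_hom: "module_hom zscale zscale mul"
proof -
  have "mul (f + g) = mul f + mul g" "mul (c *\<^sub>z g) = c *\<^sub>z mul g" for f g c
    by (auto simp: mul_def zscale_apply fun_eq_iff)
  then show ?thesis using zmod.module_axioms by (simp only: module_hom_iff) blast
qed

text \<open>On \<open>Y\<close> the matrix J acts as 0, so 2 L = q - Phi with Phi^2 = q. Squaring
  gives 4 L^2 = 4 q L - q (q - 1), where q - 1 is 4 r.\<close>

lemma L_square:
  assumes "y \<in> sum_zero" and r: "int q = 4 * r + 1"
  shows "L (L y) = int q *\<^sub>z L y - (int q * r) *\<^sub>z y"
proof
  fix x
  have y: "sum y UNIV = 0" using assms by (simp add: sum_zero_def)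
  have 1: "conv y x = int q * y x - 2 * L y x" using two_L[of y x] y by simp
  have 2: "2 * L (L y) x = int q * L y x - conv (L y) x" using two_L[of "L y" x] sum_L[of y] by simp
  have 3: "2 * conv (L y) x = int q * (int q * y x - 2 * L y x) - int q * y x"
    using two_conv_L[of y x] conv_conv[of y x] y 1 by simp
  have "4 * L (L y) x = 4 * (int q * L y x) - (int q - 1) * (int q * y x)"
    using 2 3 by (simp add: algebra_simps)
  also have "int q - 1 = 4 * r" using r by simp
  finally have "L (L y) x = int q * L y x - int q * r * y x" by (simp add: algebra_simps)
  then show "L (L y) x = (int q *\<^sub>z L y - (int q * r) *\<^sub>z y) x" by (simp add: zscale_apply)
qed

text \<open>\<open>mul\<close> anticommutes with \<open>conv\<close>, so moving it past (q - Phi) /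
  2 produces (q + Phi) / 2, which is q - L on \<open>Y\<close>.\<close>

lemma L_mul:
  assumes "y \<in> sum_zero"
  shows "L (mul y) = int q *\<^sub>z mul y - mul (L y)"
proof
  fix x
  have y: "sum y UNIV = 0" using assms by (simp add: sum_zero_def)
  have "2 * L (mul y) x = int q * mul y x + conv y (\<beta>\<^sup>2 * x)"
    using two_L[of "mul y" x] y by (simp add: conv_mul sum_mul)
  moreover have "2 * mul (L y) x = int q * mul y x - conv y (\<beta>\<^sup>2 * x)"
    using two_L[of y "\<beta>\<^sup>2 * x"] y by (simp add: mul_def)
  ultimately have "2 * L (mul y) x = 2 * (int q * mul y x - mul (L y) x)" by simp
  then show "L (mul y) x = (int q *\<^sub>z mul y - mul (L y)) x" by (simp add: zscale_apply)
qed

lemma conference: "conference_critical_group L mul (int ((p ^ t - 1) div 2)) (int (p ^ t)) (int q)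
    (int ((q - 1) div 4)) (peisert_graph \<beta>) p (2 * t)"
proof -
  define m where "m = (p ^ t - 1) div 2"
  have "odd p" using p(2) by presburger
  then have "odd (p ^ t)" by simp
  then have s: "p ^ t = 2 * m + 1" unfolding m_def by presburger
  have q_s: "q = (p ^ t)\<^sup>2" by (simp add: q mult.commute flip: power_mult)
  then have q_m: "q = 4 * (m * (m + 1)) + 1"
    unfolding s by (simp add: power2_eq_square algebra_simps)
  then have r_m: "(q - 1) div 4 = m * (m + 1)" by simp
  have "m > 0" using q_m q_ge by (cases m) auto
  show ?thesis
    unfolding m_def[symmetric]
  proof (intro conference_critical_group.intro conference_laplacian.intro
      conference_critical_group_axioms.intro)
    show "L (L y) = int q *\<^sub>z L y - (int q * int ((q - 1) div 4)) *\<^sub>z y" if "y \<in> sum_zero" for y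
      by (rule L_square[OF that]) (use q_m r_m in simp)
    show "int (p ^ t) = 2 * int m + 1" unfolding s by simp
    show "int q = (int (p ^ t))\<^sup>2" unfolding q_s by simp
    show "int ((q - 1) div 4) = int m * (int m + 1)" unfolding r_m by (simp add: algebra_simps)
    show "int q = int p ^ (2 * t)" by (simp add: q)
    show "pverts (peisert_graph \<beta>) = UNIV" by (simp add: peisert_graph_def)
  qed (use \<open>m > 0\<close> in \<open>simp_all add: L_hom mul_hom sum_L L_const bij_mul sum_mul L_mul card p(1)\<close>)
qed

end

theorem theorem3p2:
  fixes p t q r :: nat and \<beta> :: "'a :: {field, finite}"
  assumes "Factorial_Ring.prime p" and "p mod 4 = 3" and "t \<ge> 1"
    and "q = p ^ (2 * t)" and "r = (q - 1) div 4"
    and "card (UNIV :: 'a set) = q" and "primitive_element \<beta>"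
  shows "(\<exists>P Q. sylow_decomposition p (critical_group (peisert_graph \<beta>)) P Q) \<and>
    (\<forall>P Q. sylow_decomposition p (critical_group (peisert_graph \<beta>)) P Q \<longrightarrow>
       (critical_group (peisert_graph \<beta>))\<lparr>carrier := Q\<rparr>
         \<cong> product_group {..<2 * r} (\<lambda>_. integer_mod_group r) \<and>
       card P = q ^ ((q - 3) div 2))"
proof -
  have F: "quartic_field p t q \<beta>"
    using assms by (intro quartic_field.intro)
  have C: "conference_critical_group (laplacian_map (peisert_graph \<beta>)) (quartic_field.mul \<beta>)
      (int ((p ^ t - 1) div 2)) (int (p ^ t)) (int q) (int r) (peisert_graph \<beta>) p (2 * t)"
    unfolding assms(5) by (rule quartic_field.conference[OF F])
  have q: "q = 8 * (q div 8) + 1" "q \<ge> 9"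
    using quartic_field.q_mod_8[OF F] mult_div_mod_eq[of 8 q] quartic_field.q_ge[OF F] by simp_all
  then obtain k where "q div 8 = Suc k" by (cases "q div 8") auto
  then have "q = 8 * k + 9" using q(1) by simp
  \<comment> \<open>With \<open>q = 8 * k + 9\<close> both divisions are exact:
    \<open>r = 2 * k + 2\<close>, and either side equals \<open>4 * k + 3\<close>.\<close>
  then have exp: "(q - 3) div 2 = 2 * r - 1" by (simp add: assms(5))
  have nat: "nat (2 * int r) = 2 * r" "nat (int r) = r" by simp_all
  show ?thesis
  proof (intro conjI allI impI)
    show "\<exists>P Q. sylow_decomposition p (critical_group (peisert_graph \<beta>)) P Q"
      by (rule conference_critical_group.sylow_decomposition_critical_group[OF C])
    fix P Q assume PQ: "sylow_decomposition p (critical_group (peisert_graph \<beta>)) P Q"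
    note str = conference_critical_group.critical_group_structure[OF C PQ, unfolded nat]
    show "(critical_group (peisert_graph \<beta>))\<lparr>carrier := Q\<rparr>
        \<cong> product_group {..<2 * r} (\<lambda>_. integer_mod_group r)"
      by (rule str(1))
    have "int (card P) = int (q ^ (2 * r - 1))" unfolding of_nat_power by (rule str(2))
    then show "card P = q ^ ((q - 3) div 2)" unfolding exp by (simp only: of_nat_eq_iff)
  qed
qed

end
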